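(* Let $R$ be a commutative ring and $X$ a directed space. Then $HA_1(X)$ is the coequalizer, in the category of (non-unital) associative $R$-algebras, of the two algebra maps $d_0,d_1:R_2[X]\to R_1[X]$. More explicitly, $$HA_1(X)=R_1[X]/\sim,$$ where for $p,q\in R_1[X]$, $p\sim q$ if and only if there exists $z\in R_2[X]$ with $p=q+(d_0-d_1)(z)$.
   Context: A directed space (d-space) is a topological space $X$ with a set $dX$ of continuous paths $[0,1]\to X$ (the d-paths) containing all constant paths, closed under precomposition with continuous non-decreasing maps $[0,1]\to[0,1]$, and closed under concatenation. $\Delta_n=\{(t_0,\dots,t_n): t_j\ge 0,\ \sum_j t_j=1\}$ is the standard simplex, with face inclusions $\delta_k:\Delta_{n-1}\to\Delta_n$ (insert $0$ at position $k$) and degeneracies $\sigma_k:\Delta_n\to\Delta_{n-1}$, $0\le k<n$, $(t_0,\dots,t_n)\mapsto(t_0,\dots,t_k+t_{k+1},\dots,t_n)$. For $i\ge 1$, an $i$-path in $X$ is a continuous map $p:[0,1]\times\Delta_{i-1}\to X$ such that $p(\cdot,t)$ is a d-path for every $t\in\Delta_{i-1}$. For $a,b\in X$, an $i$-trace from $a$ to $b$ is a class of $i$-paths $p$ with $p(0,t)=a$ and $p(1,t)=b$ for all $t$, modulo reparametrization in the first coordinate (the equivalence relation generated by $p\sim p\circ(\varphi\times \mathrm{Id})$ with $\varphi:[0,1]\to[0,1]$ continuous, non-decreasing and surjective). The maps $d_j(p)=p\circ(\mathrm{Id}\times\delta_j)$ (from $(i+1)$-paths to $i$-paths, $0\le j\le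 i$) and $s_k(p)=p\circ(\mathrm{Id}\times\sigma_k)$ (from $i$-paths to $(i+1)$-paths, $0\le k\le i-1$) induce maps on traces preserving start and end points. $R_i[X]$, $i\ge1$, is the free $R$-module on all $i$-traces of $X$, with bilinear product determined on basis elements by $p\times q=p*q$ (concatenation in the first coordinate) if the end point of $p$ is the start point of $q$, and $p\times q=0$ otherwise. Extending $d_j,s_k$ linearly, $R[X]=(R_{i+1}[X])_{i\ge0}$ (with $R_{i+1}[X]$ in degree $i$) is a simplicial object in the category of non-unital associative $R$-algebras. For a simplicial algebra $S$ with faces $d^n_j:S_n\to S_{n-1}$, its Moore normalization $NS$ is $(NS)_n=\bigcap_{j=0}^{n-1}\ker d^n_j$ with differential $\partial^n=(-1)^n d^n_n:(NS)_n\to(NS)_{n-1}$ (zero for $n=0$). The image of $\partial^{n+1}$ is a two-sided ideal, and $H_n(NS)=\ker\partial^n/\mathrm{Im}\,\partial^{n+1}$ is an algebra. $HA_1(X)=H_0(NR[X])$, and more generally $HA_{i+1}(X)=H_i(NR[X])$ for $i\ge 0$. *)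

theory Defs
  imports "HOL-Homology.Simplices" "HOL-Algebra.Module" "HOL-Algebra.AbelCoset"
begin

section \<open>Non-unital associative algebras\<close>

text \<open>
  Algebras are carried by the library's module records, whose field \<open>one\<close> is
  inherited from rings. Algebras here have no unit: \<open>one\<close> is never constrained, and
  is \<open>undefined\<close> in the records built below.
\<close>

locale nonunital_algebra = module R A for R (structure) and A (structure) +
  assumes mult_closed:
      "\<lbrakk>x \<in> carrier A; y \<in> carrier A\<rbrakk> \<Longrightarrow> x \<otimes>\<^bsub>A\<^esub> y \<in> carrier A"
    and mult_assoc:
      "\<lbrakk>x \<in> carrier A; y \<in> carrier A; z \<in> carrier A\<rbrakk> \<Longrightarrow>
       (x \<otimes>\<^bsub>A\<^esub> y) \<otimes>\<^bsub>A\<^esub> z = x \<otimes>\<^bsub>A\<^esub> (y \<otimes>\<^bsub>A\<^esub> z)"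
    and mult_l_distr:
      "\<lbrakk>x \<in> carrier A; y \<in> carrier A; z \<in> carrier A\<rbrakk> \<Longrightarrow>
       (x \<oplus>\<^bsub>A\<^esub> y) \<otimes>\<^bsub>A\<^esub> z = x \<otimes>\<^bsub>A\<^esub> z \<oplus>\<^bsub>A\<^esub> y \<otimes>\<^bsub>A\<^esub> z"
    and mult_r_distr:
      "\<lbrakk>x \<in> carrier A; y \<in> carrier A; z \<in> carrier A\<rbrakk> \<Longrightarrow>
       x \<otimes>\<^bsub>A\<^esub> (y \<oplus>\<^bsub>A\<^esub> z) = x \<otimes>\<^bsub>A\<^esub> y \<oplus>\<^bsub>A\<^esub> x \<otimes>\<^bsub>A\<^esub> z"
    and smult_mult_l:
      "\<lbrakk>c \<in> carrier R; x \<in> carrier A; y \<in> carrier A\<rbrakk> \<Longrightarrow>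
       (c \<odot>\<^bsub>A\<^esub> x) \<otimes>\<^bsub>A\<^esub> y = c \<odot>\<^bsub>A\<^esub> (x \<otimes>\<^bsub>A\<^esub> y)"
    and smult_mult_r:
      "\<lbrakk>c \<in> carrier R; x \<in> carrier A; y \<in> carrier A\<rbrakk> \<Longrightarrow>
       x \<otimes>\<^bsub>A\<^esub> (c \<odot>\<^bsub>A\<^esub> y) = c \<odot>\<^bsub>A\<^esub> (x \<otimes>\<^bsub>A\<^esub> y)"

definition alg_hom ::
  "('r, 'm) ring_scheme \<Rightarrow> ('r, 'a) module \<Rightarrow> ('r, 'b) module \<Rightarrow> ('a \<Rightarrow> 'b) set" where
  "alg_hom R A B = {h \<in> carrier A \<rightarrow> carrier B.
     (\<forall>x\<in>carrier A. \<forall>y\<in>carrier A. h (x \<oplus>\<^bsub>A\<^esub> y) = h x \<oplus>\<^bsub>B\<^esub> h y) \<and>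
     (\<forall>x\<in>carrier A. \<forall>y\<in>carrier A. h (x \<otimes>\<^bsub>A\<^esub> y) = h x \<otimes>\<^bsub>B\<^esub> h y) \<and>
     (\<forall>c\<in>carrier R. \<forall>x\<in>carrier A. h (c \<odot>\<^bsub>A\<^esub> x) = c \<odot>\<^bsub>B\<^esub> h x)}"

text \<open>
  The first argument is the type of elements of the test algebras \<open>T\<close>; leaving it a type
  variable in a theorem yields the universal property against algebras over every type.
  Morphisms are functions considered up to equality on the carrier of their domain.
\<close>

definition is_coequalizer ::
  "'t itself \<Rightarrow> ('r, 'm) ring_scheme \<Rightarrow> ('r, 'a) module \<Rightarrow> ('r, 'b) module \<Rightarrow>
   ('a \<Rightarrow> 'b) \<Rightarrow> ('a \<Rightarrow> 'b) \<Rightarrow> ('r, 'c) module \<Rightarrow> ('b \<Rightarrow> 'c) \<Rightarrow> bool" where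
  "is_coequalizer ty R A B f g C \<pi> \<longleftrightarrow>
     nonunital_algebra R A \<and> nonunital_algebra R B \<and> nonunital_algebra R C \<and>
     f \<in> alg_hom R A B \<and> g \<in> alg_hom R A B \<and> \<pi> \<in> alg_hom R B C \<and>
     (\<forall>x\<in>carrier A. \<pi> (f x) = \<pi> (g x)) \<and>
     (\<forall>T :: ('r, 't) module. \<forall>k. nonunital_algebra R T \<and> k \<in> alg_hom R B T \<and>
        (\<forall>x\<in>carrier A. k (f x) = k (g x)) \<longrightarrow>
        (\<exists>h \<in> alg_hom R C T. (\<forall>y\<in>carrier B. h (\<pi> y) = k y) \<and>
           (\<forall>h' \<in> alg_hom R C T. (\<forall>y\<in>carrier B. h' (\<pi> y) = k y) \<longrightarrow>
              (\<forall>c\<in>carrier C. h' c = h c))))"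

definition quotient_alg :: "('r, 'a) module \<Rightarrow> ('a \<times> 'a) set \<Rightarrow> ('r, 'a set) module" where
  "quotient_alg A r = \<lparr>carrier = carrier A // r,
     mult = \<lambda>P Q. \<Union>p\<in>P. \<Union>q\<in>Q. r `` {p \<otimes>\<^bsub>A\<^esub> q},
     one = undefined,
     zero = r `` {\<zero>\<^bsub>A\<^esub>},
     add = \<lambda>P Q. \<Union>p\<in>P. \<Union>q\<in>Q. r `` {p \<oplus>\<^bsub>A\<^esub> q},
     smult = \<lambda>c P. \<Union>p\<in>P. r `` {c \<odot>\<^bsub>A\<^esub> p}\<rparr>"


section \<open>Free modules\<close>

definition supp :: "('r, 'm) ring_scheme \<Rightarrow> ('x \<Rightarrow> 'r) \<Rightarrow> 'x set" where
  "supp R f = {x. f x \<noteq> \<zero>\<^bsub>R\<^esub>}"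

text \<open>
  The free module on \<open>S\<close> consists of the finitely supported coefficient functions on \<open>S\<close>,
  set to zero outside \<open>S\<close>. The partial operation on \<open>S\<close> given by \<open>op\<close> on the pairs
  satisfying \<open>D\<close> is extended bilinearly, products of the other pairs being zero.
\<close>

definition free_alg ::
  "('r, 'm) ring_scheme \<Rightarrow> 'x set \<Rightarrow> ('x \<Rightarrow> 'x \<Rightarrow> bool) \<Rightarrow> ('x \<Rightarrow> 'x \<Rightarrow> 'x) \<Rightarrow>
   ('r, 'x \<Rightarrow> 'r) module" where
  "free_alg R S D op = \<lparr>
     carrier = {f. (\<forall>x. f x \<in> carrier R) \<and> supp R f \<subseteq> S \<and> finite (supp R f)},
     mult = \<lambda>f g z. \<Oplus>\<^bsub>R\<^esub>w \<in> {(x, y). x \<in> supp R f \<and> y \<in> supp R g \<and> D x y \<and> op x y = z}.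
              f (fst w) \<otimes>\<^bsub>R\<^esub> g (snd w),
     one = undefined,
     zero = \<lambda>x. \<zero>\<^bsub>R\<^esub>,
     add = \<lambda>f g x. f x \<oplus>\<^bsub>R\<^esub> g x,
     smult = \<lambda>c f x. c \<otimes>\<^bsub>R\<^esub> f x\<rparr>"

definition lin_ext :: "('r, 'm) ring_scheme \<Rightarrow> ('x \<Rightarrow> 'y) \<Rightarrow> ('x \<Rightarrow> 'r) \<Rightarrow> 'y \<Rightarrow> 'r" where
  "lin_ext R h f y = (\<Oplus>\<^bsub>R\<^esub>x \<in> {x \<in> supp R f. h x = y}. f x)"


section \<open>Simplicial algebras and the Moore normalization\<close>

record ('r, 'x) simplicial_alg =
  obj :: "nat \<Rightarrow> ('r, 'x) module"
  face :: "nat \<Rightarrow> nat \<Rightarrow> 'x \<Rightarrow> 'x"   \<comment> \<open>\<open>face S n j\<close> goes from degree \<open>n\<close> to degree \<open>n - 1\<close>\<close>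
  degen :: "nat \<Rightarrow> nat \<Rightarrow> 'x \<Rightarrow> 'x"  \<comment> \<open>\<open>degen S n k\<close> goes from degree \<open>n\<close> to degree \<open>n + 1\<close>\<close>

definition moore_carrier :: "('r, 'x) simplicial_alg \<Rightarrow> nat \<Rightarrow> 'x set" where
  "moore_carrier S n =
     {x \<in> carrier (obj S n). \<forall>j<n. face S n j x = \<zero>\<^bsub>obj S (n - 1)\<^esub>}"

text \<open>In degree zero, where the differential is zero, the target is taken to be \<open>obj S 0\<close>.\<close>

definition moore_diff :: "('r, 'x) simplicial_alg \<Rightarrow> nat \<Rightarrow> 'x \<Rightarrow> 'x" where
  "moore_diff S n x =
     (if n = 0 then \<zero>\<^bsub>obj S 0\<^esub>
      else if even n then face S n n x
      else \<ominus>\<^bsub>obj S (n - 1)\<^esub> (face S n n x))"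

definition moore_cycles :: "('r, 'x) simplicial_alg \<Rightarrow> nat \<Rightarrow> ('r, 'x) module" where
  "moore_cycles S n = (obj S n)\<lparr>carrier :=
     {x \<in> moore_carrier S n. moore_diff S n x = \<zero>\<^bsub>obj S (n - 1)\<^esub>}\<rparr>"

definition moore_boundaries :: "('r, 'x) simplicial_alg \<Rightarrow> nat \<Rightarrow> 'x set" where
  "moore_boundaries S n = moore_diff S (Suc n) ` moore_carrier S (Suc n)"

definition moore_homology :: "('r, 'x) simplicial_alg \<Rightarrow> nat \<Rightarrow> ('r, 'x set) module" where
  "moore_homology S n =
     quotient_alg (moore_cycles S n) (racong\<^bsub>moore_cycles S n\<^esub> (moore_boundaries S n))"


section \<open>Directed spaces and traces\<close>

text \<open>
  Maps on \<open>[0,1]\<close> and on \<open>[0,1] \<times> \<Delta>\<close> are made \<open>undefined\<close> outside their domain, so that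
  equality of functions is equality of maps.
\<close>

locale dspace =
  fixes X :: "'a topology" and dX :: "(real \<Rightarrow> 'a) set"
  assumes dpath_path: "p \<in> dX \<Longrightarrow> p \<in> extensional {0..1} \<and> pathin X p"
    and dpath_const: "x \<in> topspace X \<Longrightarrow> (\<lambda>s\<in>{0..1}. x) \<in> dX"
    and dpath_reparam:
      "\<lbrakk>p \<in> dX; continuous_on {0..1} \<phi>; \<phi> ` {0..1} \<subseteq> {0..1}; mono_on {0..1} \<phi>\<rbrakk> \<Longrightarrow>
       (\<lambda>s\<in>{0..1}. p (\<phi> s)) \<in> dX"
    and dpath_concat:
      "\<lbrakk>p \<in> dX; q \<in> dX; p 1 = q 0\<rbrakk> \<Longrightarrow>
       (\<lambda>s\<in>{0..1}. if s \<le> 1 / 2 then p (2 * s) else q (2 * s - 1)) \<in> dX"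

abbreviation simplex_topology :: "nat \<Rightarrow> (nat \<Rightarrow> real) topology" where
  "simplex_topology n \<equiv> subtopology (powertop_real UNIV) (standard_simplex n)"

definition simplicial_degen :: "nat \<Rightarrow> (nat \<Rightarrow> real) \<Rightarrow> nat \<Rightarrow> real" where
  "simplicial_degen k t =
     (\<lambda>i. if i < k then t i else if i = k then t k + t (Suc k) else t (Suc i))"

type_synonym 'a ipath = "real \<times> (nat \<Rightarrow> real) \<Rightarrow> 'a"

abbreviation ipath_dom :: "nat \<Rightarrow> (real \<times> (nat \<Rightarrow> real)) set" where
  "ipath_dom i \<equiv> {0..1} \<times> standard_simplex (i - 1)"

text \<open>Here and below the index \<open>i\<close> of an \<open>i\<close>-path is meant to be at least 1.\<close>

definition ipaths :: "'a topology \<Rightarrow> (real \<Rightarrow> 'a) set \<Rightarrow> nat \<Rightarrow> 'a ipath set" where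
  "ipaths X dX i = {p \<in> extensional (ipath_dom i).
     continuous_map (prod_topology (top_of_set {0..1}) (simplex_topology (i - 1))) X p \<and>
     (\<forall>t\<in>standard_simplex (i - 1). (\<lambda>s\<in>{0..1}. p (s, t)) \<in> dX)}"

definition ipaths_between ::
  "'a topology \<Rightarrow> (real \<Rightarrow> 'a) set \<Rightarrow> nat \<Rightarrow> 'a \<Rightarrow> 'a \<Rightarrow> 'a ipath set" where
  "ipaths_between X dX i a b =
     {p \<in> ipaths X dX i. \<forall>t\<in>standard_simplex (i - 1). p (0, t) = a \<and> p (1, t) = b}"

definition reparam_step ::
  "'a topology \<Rightarrow> (real \<Rightarrow> 'a) set \<Rightarrow> nat \<Rightarrow> 'a ipath \<Rightarrow> 'a ipath \<Rightarrow> bool" where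
  "reparam_step X dX i p q \<longleftrightarrow> p \<in> ipaths X dX i \<and>
     (\<exists>\<phi>. continuous_on {0..1} \<phi> \<and> mono_on {0..1} \<phi> \<and> \<phi> ` {0..1} = {0..1} \<and>
          q = (\<lambda>(s, t)\<in>ipath_dom i. p (\<phi> s, t)))"

definition trace_class ::
  "'a topology \<Rightarrow> (real \<Rightarrow> 'a) set \<Rightarrow> nat \<Rightarrow> 'a ipath \<Rightarrow> 'a ipath set" where
  "trace_class X dX i p = {q. equivclp (reparam_step X dX i) p q}"

definition traces_between ::
  "'a topology \<Rightarrow> (real \<Rightarrow> 'a) set \<Rightarrow> nat \<Rightarrow> 'a \<Rightarrow> 'a \<Rightarrow> 'a ipath set set" where
  "traces_between X dX i a b = trace_class X dX i ` ipaths_between X dX i a b"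

definition traces ::
  "'a topology \<Rightarrow> (real \<Rightarrow> 'a) set \<Rightarrow> nat \<Rightarrow> 'a ipath set set" where
  "traces X dX i = (\<Union>a\<in>topspace X. \<Union>b\<in>topspace X. traces_between X dX i a b)"

definition ipath_concat :: "nat \<Rightarrow> 'a ipath \<Rightarrow> 'a ipath \<Rightarrow> 'a ipath" where
  "ipath_concat i p q =
     (\<lambda>(s, t)\<in>ipath_dom i. if s \<le> 1 / 2 then p (2 * s, t) else q (2 * s - 1, t))"

text \<open>From \<open>(i + 1)\<close>-paths to \<open>i\<close>-paths, for \<open>j \<le> i\<close>.\<close>

definition ipath_face :: "nat \<Rightarrow> nat \<Rightarrow> 'a ipath \<Rightarrow> 'a ipath" where
  "ipath_face i j p = (\<lambda>(s, t)\<in>ipath_dom i. p (s, simplical_face j t))"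

text \<open>From \<open>i\<close>-paths to \<open>(i + 1)\<close>-paths, for \<open>k < i\<close>.\<close>

definition ipath_degen :: "nat \<Rightarrow> nat \<Rightarrow> 'a ipath \<Rightarrow> 'a ipath" where
  "ipath_degen i k p = (\<lambda>(s, t)\<in>ipath_dom (Suc i). p (s, simplicial_degen k t))"

definition composable ::
  "'a topology \<Rightarrow> (real \<Rightarrow> 'a) set \<Rightarrow> nat \<Rightarrow> 'a ipath set \<Rightarrow> 'a ipath set \<Rightarrow> bool" where
  "composable X dX i P Q \<longleftrightarrow>
     (\<exists>a b c. P \<in> traces_between X dX i a b \<and> Q \<in> traces_between X dX i b c)"

text \<open>
  The operations on representatives respect the classes, so each of the following unions
  is a union of equal sets when applied to traces (to composable ones for concatenation).
\<close>

definition trace_concat ::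
  "'a topology \<Rightarrow> (real \<Rightarrow> 'a) set \<Rightarrow> nat \<Rightarrow> 'a ipath set \<Rightarrow> 'a ipath set \<Rightarrow> 'a ipath set" where
  "trace_concat X dX i P Q = (\<Union>p\<in>P. \<Union>q\<in>Q. trace_class X dX i (ipath_concat i p q))"

definition trace_face ::
  "'a topology \<Rightarrow> (real \<Rightarrow> 'a) set \<Rightarrow> nat \<Rightarrow> nat \<Rightarrow> 'a ipath set \<Rightarrow> 'a ipath set" where
  "trace_face X dX i j P = (\<Union>p\<in>P. trace_class X dX i (ipath_face i j p))"

definition trace_degen ::
  "'a topology \<Rightarrow> (real \<Rightarrow> 'a) set \<Rightarrow> nat \<Rightarrow> nat \<Rightarrow> 'a ipath set \<Rightarrow> 'a ipath set" where
  "trace_degen X dX i k P = (\<Union>p\<in>P. trace_class X dX (Suc i) (ipath_degen i k p))"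


section \<open>Path algebras and homology algebras\<close>

definition trace_alg ::
  "('r, 'm) ring_scheme \<Rightarrow> 'a topology \<Rightarrow> (real \<Rightarrow> 'a) set \<Rightarrow> nat \<Rightarrow>
   ('r, 'a ipath set \<Rightarrow> 'r) module" where
  "trace_alg R X dX i =
     free_alg R (traces X dX i) (composable X dX i) (trace_concat X dX i)"

definition trace_face_lin ::
  "('r, 'm) ring_scheme \<Rightarrow> 'a topology \<Rightarrow> (real \<Rightarrow> 'a) set \<Rightarrow> nat \<Rightarrow> nat \<Rightarrow>
   ('a ipath set \<Rightarrow> 'r) \<Rightarrow> 'a ipath set \<Rightarrow> 'r" where
  "trace_face_lin R X dX i j = lin_ext R (trace_face X dX i j)"

definition trace_degen_lin ::
  "('r, 'm) ring_scheme \<Rightarrow> 'a topology \<Rightarrow> (real \<Rightarrow> 'a) set \<Rightarrow> nat \<Rightarrow> nat \<Rightarrow>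
   ('a ipath set \<Rightarrow> 'r) \<Rightarrow> 'a ipath set \<Rightarrow> 'r" where
  "trace_degen_lin R X dX i k = lin_ext R (trace_degen X dX i k)"

text \<open>Degree \<open>n\<close> holds the \<open>(n + 1)\<close>-traces, so a face map out of degree \<open>n\<close> lands in \<open>n\<close>-traces.\<close>

definition simplicial_trace_alg ::
  "('r, 'm) ring_scheme \<Rightarrow> 'a topology \<Rightarrow> (real \<Rightarrow> 'a) set \<Rightarrow>
   ('r, 'a ipath set \<Rightarrow> 'r) simplicial_alg" where
  "simplicial_trace_alg R X dX = \<lparr>
     obj = \<lambda>n. trace_alg R X dX (Suc n),
     face = \<lambda>n j. trace_face_lin R X dX n j,
     degen = \<lambda>n k. trace_degen_lin R X dX (Suc n) k\<rparr>"

text \<open>Meaningful for \<open>i \<ge> 1\<close>.\<close>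

definition HA ::
  "('r, 'm) ring_scheme \<Rightarrow> 'a topology \<Rightarrow> (real \<Rightarrow> 'a) set \<Rightarrow> nat \<Rightarrow>
   ('r, ('a ipath set \<Rightarrow> 'r) set) module" where
  "HA R X dX i = moore_homology (simplicial_trace_alg R X dX) (i - 1)"

definition face_rel ::
  "('r, 'm) ring_scheme \<Rightarrow> 'a topology \<Rightarrow> (real \<Rightarrow> 'a) set \<Rightarrow>
   (('a ipath set \<Rightarrow> 'r) \<times> ('a ipath set \<Rightarrow> 'r)) set" where
  "face_rel R X dX = {(p, q).
     p \<in> carrier (trace_alg R X dX 1) \<and> q \<in> carrier (trace_alg R X dX 1) \<and>
     (\<exists>z\<in>carrier (trace_alg R X dX 2).
        p = q \<oplus>\<^bsub>trace_alg R X dX 1\<^esub>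
          (trace_face_lin R X dX 1 0 z \<ominus>\<^bsub>trace_alg R X dX 1\<^esub> trace_face_lin R X dX 1 1 z))}"

end

theory Submission
  imports Defs
begin

text \<open>
  The faces \<open>f = d\<^sub>0\<close> and \<open>g = d\<^sub>1\<close> form a reflexive pair: every trace is both faces of the 2-trace
  that is constant along the simplex. Hence a pair \<open>(p, q)\<close> satisfies \<open>p = q + (f z - g z)\<close> for some
  \<open>z\<close> iff it is \<open>(f x, g x)\<close> for some \<open>x\<close>, which makes the relation an algebra congruence. Subtracting
  from \<open>z\<close> a common preimage of \<open>f z\<close> moves it into the kernel of \<open>f\<close>, so that the congruence is
  the one defined by the Moore boundaries.
\<close>

text \<open>The obstacle is multiplication. The map \<open>f - g\<close> is linear but not
  multiplicative, so its image is not visibly an ideal. The pairs \<open>(f x, g x)\<close> form the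
  image of an algebra map into the product of two copies of the target, and such an image is closed
  under every operation; reflexivity pays for the passage from differences to pairs. All that is
  asked of a section is that each element have a common preimage under \<open>f\<close> and
  \<open>g\<close>. This property passes to sums, so it comes down to single traces. A second
  obstacle lies in the algebra structure: concatenation is partial, and associative only up to
  reparametrization. Passing to traces restores associativity where concatenation is defined. Since
  undefined products become zero, the two bracketings of three traces must moreover be defined
  simultaneously. For traces this holds because either one is defined exactly when the successive
  end points match.\<close>

section \<open>Free algebras on partial semigroups\<close>

definition single :: "('r, 'm) ring_scheme \<Rightarrow> 'x \<Rightarrow> 'r \<Rightarrow> 'x \<Rightarrow> 'r" where
  "single R x c = (\<lambda>y. if y = x then c else \<zero>\<^bsub>R\<^esub>)"

text \<open>Products and linear extensions sum over supports, which vary with the arguments.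
  Enlarging the index set by zero terms lets several such sums be compared over one common finite
  set.\<close>

lemma (in cring) finsum_supp_superset:
  assumes "finite W" "V \<subseteq> W" "\<And>w. w \<in> W \<Longrightarrow> h w \<in> carrier R" "\<And>w. w \<in> W - V \<Longrightarrow> h w = \<zero>"
  shows "finsum R h V = finsum R h W"
  by (rule add.finprod_mono_neutral_cong_left) (use assms in auto)

text \<open>\<open>D_assoc\<close> is an equivalence because undefined products become zero in the
  algebra: if only one bracketing were defined, one side of the associative law could be nonzero
  while the other vanished.\<close>

locale partial_semigroup =
  fixes S :: "'x set" and D :: "'x \<Rightarrow> 'x \<Rightarrow> bool" and op :: "'x \<Rightarrow> 'x \<Rightarrow> 'x"
  assumes op_closed: "\<lbrakk>x \<in> S; y \<in> S; D x y\<rbrakk> \<Longrightarrow> op x y \<in> S"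
    and D_assoc: "\<lbrakk>x \<in> S; y \<in> S; z \<in> S\<rbrakk> \<Longrightarrow>
      (D x y \<and> D (op x y) z) \<longleftrightarrow> (D y z \<and> D x (op y z))"
    and op_assoc: "\<lbrakk>x \<in> S; y \<in> S; z \<in> S; D x y; D (op x y) z\<rbrakk> \<Longrightarrow>
      op (op x y) z = op x (op y z)"

locale free_partial_alg = cring R + partial_semigroup S D op
  for R :: "('r, 'm) ring_scheme" (structure)
    and S :: "'x set" and D :: "'x \<Rightarrow> 'x \<Rightarrow> bool" and op :: "'x \<Rightarrow> 'x \<Rightarrow> 'x"
begin

abbreviation "A \<equiv> free_alg R S D op"

lemma A_simps:
  "f \<in> carrier A \<longleftrightarrow> (\<forall>x. f x \<in> carrier R) \<and> supp R f \<subseteq> S \<and> finite (supp R f)"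
  "\<zero>\<^bsub>A\<^esub> = (\<lambda>x. \<zero>)"
  "f \<oplus>\<^bsub>A\<^esub> g = (\<lambda>x. f x \<oplus> g x)"
  "c \<odot>\<^bsub>A\<^esub> f = (\<lambda>x. c \<otimes> f x)"
  by (auto simp: free_alg_def)

lemma supp_add: "supp R (\<lambda>x. f x \<oplus> g x) \<subseteq> supp R f \<union> supp R g"
  by (auto simp: supp_def)

lemma supp_smult: "c \<in> carrier R \<Longrightarrow> supp R (\<lambda>x. c \<otimes> f x) \<subseteq> supp R f"
  by (auto simp: supp_def)

lemma supp_single: "supp R (single R x c) \<subseteq> {x}"
  by (auto simp: supp_def single_def)

lemma A_add_closed: "f \<in> carrier A \<Longrightarrow> g \<in> carrier A \<Longrightarrow> f \<oplus>\<^bsub>A\<^esub> g \<in> carrier A"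
  using supp_add[of f g] by (auto simp: A_simps intro: finite_subset)

lemma A_smult_closed: "c \<in> carrier R \<Longrightarrow> f \<in> carrier A \<Longrightarrow> c \<odot>\<^bsub>A\<^esub> f \<in> carrier A"
  using supp_smult[of c f] by (auto simp: A_simps intro: finite_subset)

lemma A_zero_closed: "\<zero>\<^bsub>A\<^esub> \<in> carrier A"
  by (simp add: A_simps supp_def)

lemma single_closed: "x \<in> S \<Longrightarrow> c \<in> carrier R \<Longrightarrow> single R x c \<in> carrier A"
  using supp_single[of x c] by (auto simp: A_simps single_def intro: finite_subset)

lemma abelian_group_A: "abelian_group A"
proof (rule abelian_groupI)
  fix f assume f: "f \<in> carrier A"
  show "\<exists>g\<in>carrier A. g \<oplus>\<^bsub>A\<^esub> f = \<zero>\<^bsub>A\<^esub>"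
  proof (rule bexI)
    show "(\<ominus> \<one>) \<odot>\<^bsub>A\<^esub> f \<oplus>\<^bsub>A\<^esub> f = \<zero>\<^bsub>A\<^esub>"
      using f by (auto simp: A_simps l_minus l_neg)
  qed (use f in \<open>simp add: A_smult_closed\<close>)
qed (auto simp: A_add_closed A_zero_closed, auto simp: A_simps a_ac)

lemma module_A: "module R A"
  by (rule moduleI[OF is_cring abelian_group_A A_smult_closed])
    (auto simp: A_simps l_distr r_distr m_assoc)

text \<open>The support is peeled off one point at a time. The coefficient is part of
  \<open>single\<close>, so no case for scalar multiples is needed.\<close>

lemma free_induct [consumes 1, case_names zero single add]:
  assumes "f \<in> carrier A"
    and zero: "P \<zero>\<^bsub>A\<^esub>"
    and single: "\<And>x c. x \<in> S \<Longrightarrow> c \<in> carrier R \<Longrightarrow> P (single R x c)"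
    and add: "\<And>f g. f \<in> carrier A \<Longrightarrow> g \<in> carrier A \<Longrightarrow> P f \<Longrightarrow> P g \<Longrightarrow> P (f \<oplus>\<^bsub>A\<^esub> g)"
  shows "P f"
proof -
  have "finite F \<Longrightarrow> supp R f \<subseteq> F \<Longrightarrow> f \<in> carrier A \<Longrightarrow> P f" for F f
  proof (induction F arbitrary: f rule: finite_induct)
    case empty
    then have "f = \<zero>\<^bsub>A\<^esub>" by (auto simp: A_simps supp_def)
    with zero show ?case by simp
  next
    case (insert x F)
    show ?case
    proof (cases "f x = \<zero>")
      case True
      with insert.prems have "supp R f \<subseteq> F" by (auto simp: supp_def)
      with insert show ?thesis by blast
    next
      case False
      define g where "g = f(x := \<zero>)"
      have xS: "x \<in> S" and fx: "f x \<in> carrier R"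
        using insert.prems False by (auto simp: A_simps supp_def)
      have sub: "supp R g \<subseteq> supp R f" by (auto simp: g_def supp_def)
      then have g: "g \<in> carrier A"
        using insert.prems by (auto simp: A_simps g_def intro: finite_subset)
      have "supp R g \<subseteq> F" using insert.prems by (auto simp: g_def supp_def)
      then have "P g" using insert.IH g by blast
      moreover have "f = single R x (f x) \<oplus>\<^bsub>A\<^esub> g"
        using insert.prems by (auto simp: A_simps single_def g_def)
      ultimately show ?thesis
        using add[OF single_closed[OF xS fx] g single[OF xS fx]] by simp
    qed
  qed
  with assms(1) show ?thesis by (auto simp: A_simps)
qed

text \<open>With a rectangle \<open>F\<close> times \<open>G\<close> in place of the supports, the
  index set no longer depends on the factors, and distributivity can be read off term by
  term.\<close>

lemma mult_eq:
  assumes "finite F" "supp R f \<subseteq> F" "finite G" "supp R g \<subseteq> G"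
    and "\<And>x. f x \<in> carrier R" "\<And>x. g x \<in> carrier R"
  shows "(f \<otimes>\<^bsub>A\<^esub> g) z =
    (\<Oplus>w\<in>{(x, y). x \<in> F \<and> y \<in> G \<and> D x y \<and> op x y = z}. f (fst w) \<otimes> g (snd w))"
  unfolding free_alg_def monoid.simps
proof (rule finsum_supp_superset)
  show "finite {(x, y). x \<in> F \<and> y \<in> G \<and> D x y \<and> op x y = z}"
    by (rule finite_subset[of _ "F \<times> G"]) (use assms in auto)
qed (use assms in \<open>auto simp: supp_def\<close>)

lemma A_mult_closed:
  assumes "f \<in> carrier A" "g \<in> carrier A"
  shows "f \<otimes>\<^bsub>A\<^esub> g \<in> carrier A"
proof -
  have fg: "finite (supp R f)" "finite (supp R g)" "supp R f \<subseteq> S" "supp R g \<subseteq> S"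
    "\<And>x. f x \<in> carrier R" "\<And>x. g x \<in> carrier R"
    using assms by (auto simp: A_simps)
  note eq = mult_eq[OF fg(1) order_refl fg(2) order_refl fg(5,6)]
  let ?W = "{(x, y). x \<in> supp R f \<and> y \<in> supp R g \<and> D x y}"
  \<comment> \<open>A nonzero coefficient at \<open>z\<close> needs a nonempty sum, hence a pair of
    support points composing to \<open>z\<close>.\<close>
  have "supp R (f \<otimes>\<^bsub>A\<^esub> g) \<subseteq> (\<lambda>(x, y). op x y) ` ?W"
  proof
    fix z assume "z \<in> supp R (f \<otimes>\<^bsub>A\<^esub> g)"
    then have "{(x, y). x \<in> supp R f \<and> y \<in> supp R g \<and> D x y \<and> op x y = z} \<noteq> {}"
      unfolding supp_def[of R "f \<otimes>\<^bsub>A\<^esub> g"] mem_Collect_eq eq by (metis finsum_empty)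
    then show "z \<in> (\<lambda>(x, y). op x y) ` ?W" by force
  qed
  moreover have "finite ?W"
    by (rule finite_subset[of _ "supp R f \<times> supp R g"]) (use fg in auto)
  moreover have "(\<lambda>(x, y). op x y) ` ?W \<subseteq> S"
    using fg(3,4) by (auto intro!: op_closed)
  moreover have "(f \<otimes>\<^bsub>A\<^esub> g) z \<in> carrier R" for z
    unfolding eq by (rule finsum_closed) (use fg in auto)
  ultimately show ?thesis
    unfolding A_simps by (meson finite_imageI finite_subset order_trans)
qed

lemma A_l_distr:
  assumes "f \<in> carrier A" "g \<in> carrier A" "h \<in> carrier A"
  shows "(f \<oplus>\<^bsub>A\<^esub> g) \<otimes>\<^bsub>A\<^esub> h = f \<otimes>\<^bsub>A\<^esub> h \<oplus>\<^bsub>A\<^esub> g \<otimes>\<^bsub>A\<^esub> h"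
proof
  fix z
  let ?F = "supp R f \<union> supp R g"
  have fin: "finite ?F" "finite (supp R h)"
    and c: "\<And>x. f x \<in> carrier R" "\<And>x. g x \<in> carrier R" "\<And>x. h x \<in> carrier R"
    using assms by (auto simp: A_simps)
  show "((f \<oplus>\<^bsub>A\<^esub> g) \<otimes>\<^bsub>A\<^esub> h) z = (f \<otimes>\<^bsub>A\<^esub> h \<oplus>\<^bsub>A\<^esub> g \<otimes>\<^bsub>A\<^esub> h) z"
    unfolding A_simps
    by (subst (1 2 3) mult_eq[OF fin(1) _ fin(2) order_refl])
      (use c supp_add[of f g] in \<open>auto simp: l_distr intro!: finsum_addf\<close>)
qed

lemma A_r_distr:
  assumes "f \<in> carrier A" "g \<in> carrier A" "h \<in> carrier A"
  shows "h \<otimes>\<^bsub>A\<^esub> (f \<oplus>\<^bsub>A\<^esub> g) = h \<otimes>\<^bsub>A\<^esub> f \<oplus>\<^bsub>A\<^esub> h \<otimes>\<^bsub>A\<^esub> g"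
proof
  fix z
  let ?F = "supp R f \<union> supp R g"
  have fin: "finite ?F" "finite (supp R h)"
    and c: "\<And>x. f x \<in> carrier R" "\<And>x. g x \<in> carrier R" "\<And>x. h x \<in> carrier R"
    using assms by (auto simp: A_simps)
  show "(h \<otimes>\<^bsub>A\<^esub> (f \<oplus>\<^bsub>A\<^esub> g)) z = (h \<otimes>\<^bsub>A\<^esub> f \<oplus>\<^bsub>A\<^esub> h \<otimes>\<^bsub>A\<^esub> g) z"
    unfolding A_simps
    by (subst (1 2 3) mult_eq[OF fin(2) order_refl fin(1)])
      (use c supp_add[of f g] in \<open>auto simp: r_distr intro!: finsum_addf\<close>)
qed

lemma A_smult_mult_l:
  assumes a: "a \<in> carrier R" and "f \<in> carrier A" "g \<in> carrier A"
  shows "(a \<odot>\<^bsub>A\<^esub> f) \<otimes>\<^bsub>A\<^esub> g = a \<odot>\<^bsub>A\<^esub> (f \<otimes>\<^bsub>A\<^esub> g)"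
proof
  fix z
  have fin: "finite (supp R f)" "finite (supp R g)"
    and c: "\<And>x. f x \<in> carrier R" "\<And>x. g x \<in> carrier R"
    using assms by (auto simp: A_simps)
  let ?W = "{(x, y). x \<in> supp R f \<and> y \<in> supp R g \<and> D x y \<and> op x y = z}"
  have "finite ?W"
    by (rule finite_subset[of _ "supp R f \<times> supp R g"]) (use fin in auto)
  then show "((a \<odot>\<^bsub>A\<^esub> f) \<otimes>\<^bsub>A\<^esub> g) z = (a \<odot>\<^bsub>A\<^esub> (f \<otimes>\<^bsub>A\<^esub> g)) z"
    unfolding A_simps
    by (subst (1 2) mult_eq[OF fin(1) _ fin(2) order_refl])
      (use a c supp_smult[OF a, of f] in \<open>auto simp: m_assoc finsum_rdistr\<close>)
qed

lemma A_smult_mult_r: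
  assumes a: "a \<in> carrier R" and "f \<in> carrier A" "g \<in> carrier A"
  shows "f \<otimes>\<^bsub>A\<^esub> (a \<odot>\<^bsub>A\<^esub> g) = a \<odot>\<^bsub>A\<^esub> (f \<otimes>\<^bsub>A\<^esub> g)"
proof
  fix z
  have fin: "finite (supp R f)" "finite (supp R g)"
    and c: "\<And>x. f x \<in> carrier R" "\<And>x. g x \<in> carrier R"
    using assms by (auto simp: A_simps)
  let ?W = "{(x, y). x \<in> supp R f \<and> y \<in> supp R g \<and> D x y \<and> op x y = z}"
  have "finite ?W"
    by (rule finite_subset[of _ "supp R f \<times> supp R g"]) (use fin in auto)
  then show "(f \<otimes>\<^bsub>A\<^esub> (a \<odot>\<^bsub>A\<^esub> g)) z = (a \<odot>\<^bsub>A\<^esub> (f \<otimes>\<^bsub>A\<^esub> g)) z"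
    unfolding A_simps
    by (subst (1 2) mult_eq[OF fin(1) order_refl fin(2)])
      (use a c supp_smult[OF a, of g] in \<open>auto simp: m_lcomm finsum_rdistr\<close>)
qed

lemma single_mult_single:
  assumes "c \<in> carrier R" "d \<in> carrier R"
  shows "single R x c \<otimes>\<^bsub>A\<^esub> single R y d =
    (if D x y then single R (op x y) (c \<otimes> d) else \<zero>\<^bsub>A\<^esub>)"
proof
  fix z
  have W: "{(x', y'). x' \<in> {x} \<and> y' \<in> {y} \<and> D x' y' \<and> op x' y' = z} =
    (if D x y \<and> op x y = z then {(x, y)} else {})"
    by auto
  have "(single R x c \<otimes>\<^bsub>A\<^esub> single R y d) z =
    (\<Oplus>w\<in>(if D x y \<and> op x y = z then {(x, y)} else {}).
      single R x c (fst w) \<otimes> single R y d (snd w))"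
    unfolding W[symmetric]
    by (rule mult_eq[OF _ supp_single _ supp_single]) (use assms in \<open>auto simp: single_def\<close>)
  then show "(single R x c \<otimes>\<^bsub>A\<^esub> single R y d) z =
    (if D x y then single R (op x y) (c \<otimes> d) else \<zero>\<^bsub>A\<^esub>) z"
    using assms by (auto simp: A_simps single_def)
qed

lemma A_zero_mult:
  assumes "f \<in> carrier A"
  shows "\<zero>\<^bsub>A\<^esub> \<otimes>\<^bsub>A\<^esub> f = \<zero>\<^bsub>A\<^esub>" "f \<otimes>\<^bsub>A\<^esub> \<zero>\<^bsub>A\<^esub> = \<zero>\<^bsub>A\<^esub>"
proof -
  have "\<zero> \<odot>\<^bsub>A\<^esub> g = \<zero>\<^bsub>A\<^esub>" if "g \<in> carrier A" for g
    using that by (auto simp: A_simps)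
  then show "\<zero>\<^bsub>A\<^esub> \<otimes>\<^bsub>A\<^esub> f = \<zero>\<^bsub>A\<^esub>" "f \<otimes>\<^bsub>A\<^esub> \<zero>\<^bsub>A\<^esub> = \<zero>\<^bsub>A\<^esub>"
    \<comment> \<open>Zero is written as the scalar zero times \<open>f\<close>, and the scalar is
      pulled out of the product.\<close>
    using A_smult_mult_l[of \<zero> f f] A_smult_mult_r[of \<zero> f f] assms A_mult_closed by auto
qed

text \<open>By \<open>D_assoc\<close>, either both sides vanish or both are single terms, which
  \<open>op_assoc\<close> identifies.\<close>

lemma A_mult_assoc_single:
  assumes "x \<in> S" "y \<in> S" "z \<in> S" "a \<in> carrier R" "b \<in> carrier R" "c \<in> carrier R"
  shows "(single R x a \<otimes>\<^bsub>A\<^esub> single R y b) \<otimes>\<^bsub>A\<^esub> single R z c =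
    single R x a \<otimes>\<^bsub>A\<^esub> (single R y b \<otimes>\<^bsub>A\<^esub> single R z c)"
  using assms D_assoc[of x y z] op_assoc[of x y z]
  by (auto simp: single_mult_single A_zero_mult single_closed m_assoc)

text \<open>Both sides are additive in each argument, so three nested inductions reduce the claim to
  generators.\<close>

lemma A_mult_assoc:
  assumes "f \<in> carrier A" "g \<in> carrier A" "h \<in> carrier A"
  shows "(f \<otimes>\<^bsub>A\<^esub> g) \<otimes>\<^bsub>A\<^esub> h = f \<otimes>\<^bsub>A\<^esub> (g \<otimes>\<^bsub>A\<^esub> h)"
  using assms(1)
proof (induction rule: free_induct)
  case zero
  then show ?case using assms by (simp add: A_zero_mult A_mult_closed)
next
  case (add f f')
  then show ?case using assms by (simp add: A_l_distr A_mult_closed)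
next
  case (single x a)
  note x = single single_closed[OF single]
  show ?case
    using assms(2)
  proof (induction rule: free_induct)
    case zero
    then show ?case using assms x by (simp add: A_zero_mult)
  next
    case (add f f')
    then show ?case using assms x by (simp add: A_l_distr A_r_distr A_mult_closed)
  next
    case (single y b)
    note y = single single_closed[OF single]
    show ?case
      using assms(3)
    proof (induction rule: free_induct)
      case zero
      then show ?case using x y by (simp add: A_zero_mult A_mult_closed)
    next
      case (add f f')
      then show ?case using x y by (simp add: A_r_distr A_mult_closed)
    next
      case (single z c)
      then show ?case using x y by (intro A_mult_assoc_single)
    qed
  qed
qed

lemma nonunital_algebra_A: "nonunital_algebra R A"
  by (intro nonunital_algebra.intro module_A nonunital_algebra_axioms.intro A_mult_closed
      A_mult_assoc A_l_distr A_r_distr A_smult_mult_l A_smult_mult_r)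

end

section \<open>Linear extension of maps between generators\<close>

lemma (in cring) lin_ext_eq:
  assumes "finite F" "supp R f \<subseteq> F" "\<And>x. f x \<in> carrier R"
  shows "lin_ext R h f y = (\<Oplus>x\<in>{x \<in> F. h x = y}. f x)"
  unfolding lin_ext_def
  by (rule finsum_supp_superset) (use assms in \<open>auto simp: supp_def\<close>)

lemma (in cring) lin_ext_single:
  assumes "c \<in> carrier R"
  shows "lin_ext R h (single R x c) = single R (h x) c"
proof
  fix y
  have "{x' \<in> {x}. h x' = y} = (if h x = y then {x} else {})" by auto
  then show "lin_ext R h (single R x c) y = single R (h x) c y"
    by (subst lin_ext_eq[of "{x}"]) (use assms in \<open>auto simp: single_def supp_def\<close>)
qed

text \<open>\<open>map_D\<close> must also reflect composability: if \<open>h x\<close> and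
  \<open>h y\<close> were composable while \<open>x\<close> and \<open>y\<close> were not, a zero
  product would have to go to a possibly nonzero one.\<close>

locale free_partial_alg_map =
  src: free_partial_alg R S D op + tgt: free_partial_alg R S' D' op'
  for R :: "('r, 'm) ring_scheme" (structure)
    and S :: "'x set" and D op and S' :: "'y set" and D' op' +
  fixes h :: "'x \<Rightarrow> 'y"
  assumes map_closed: "x \<in> S \<Longrightarrow> h x \<in> S'"
    and map_D: "\<lbrakk>x \<in> S; y \<in> S\<rbrakk> \<Longrightarrow> D' (h x) (h y) \<longleftrightarrow> D x y"
    and map_op: "\<lbrakk>x \<in> S; y \<in> S; D x y\<rbrakk> \<Longrightarrow> h (op x y) = op' (h x) (h y)"
begin

lemma lin_ext_add:
  assumes "f \<in> carrier src.A" "g \<in> carrier src.A"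
  shows "lin_ext R h (f \<oplus>\<^bsub>src.A\<^esub> g) = lin_ext R h f \<oplus>\<^bsub>tgt.A\<^esub> lin_ext R h g"
proof
  fix y
  let ?F = "supp R f \<union> supp R g"
  have fin: "finite ?F" and c: "\<And>x. f x \<in> carrier R" "\<And>x. g x \<in> carrier R"
    using assms by (auto simp: src.A_simps)
  show "lin_ext R h (f \<oplus>\<^bsub>src.A\<^esub> g) y = (lin_ext R h f \<oplus>\<^bsub>tgt.A\<^esub> lin_ext R h g) y"
    unfolding src.A_simps tgt.A_simps
    by (subst (1 2 3) src.lin_ext_eq[OF fin])
      (use c src.supp_add[of f g] in \<open>auto intro!: src.finsum_addf\<close>)
qed

lemma lin_ext_smult:
  assumes a: "a \<in> carrier R" and "f \<in> carrier src.A"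
  shows "lin_ext R h (a \<odot>\<^bsub>src.A\<^esub> f) = a \<odot>\<^bsub>tgt.A\<^esub> lin_ext R h f"
proof
  fix y
  have fin: "finite (supp R f)" and c: "\<And>x. f x \<in> carrier R"
    using assms by (auto simp: src.A_simps)
  show "lin_ext R h (a \<odot>\<^bsub>src.A\<^esub> f) y = (a \<odot>\<^bsub>tgt.A\<^esub> lin_ext R h f) y"
    unfolding src.A_simps tgt.A_simps
    by (subst (1 2) src.lin_ext_eq[OF fin])
      (use a fin c src.supp_smult[OF a, of f] in \<open>auto simp: src.finsum_rdistr\<close>)
qed

lemma lin_ext_zero: "lin_ext R h \<zero>\<^bsub>src.A\<^esub> = \<zero>\<^bsub>tgt.A\<^esub>"
  by (auto simp: src.A_simps tgt.A_simps lin_ext_def supp_def)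

lemma lin_ext_closed:
  assumes "f \<in> carrier src.A"
  shows "lin_ext R h f \<in> carrier tgt.A"
  using assms
proof (induction rule: src.free_induct)
  case zero
  then show ?case by (simp add: lin_ext_zero tgt.A_zero_closed)
next
  case (single x c)
  then show ?case by (simp add: src.lin_ext_single map_closed tgt.single_closed)
next
  case (add f g)
  then show ?case by (simp add: lin_ext_add tgt.A_add_closed)
qed

lemma lin_ext_mult:
  assumes "f \<in> carrier src.A" "g \<in> carrier src.A"
  shows "lin_ext R h (f \<otimes>\<^bsub>src.A\<^esub> g) = lin_ext R h f \<otimes>\<^bsub>tgt.A\<^esub> lin_ext R h g"
  using assms(1)
proof (induction rule: src.free_induct)
  case zero
  then show ?case using assms(2)
    by (simp add: src.A_zero_mult tgt.A_zero_mult lin_ext_zero lin_ext_closed)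
next
  case (add f f')
  then show ?case using assms(2)
    by (simp add: src.A_l_distr tgt.A_l_distr lin_ext_add lin_ext_closed src.A_mult_closed)
next
  case (single x a)
  note x = single src.single_closed[OF single]
  show ?case
    using assms(2)
  proof (induction rule: src.free_induct)
    case zero
    then show ?case using x
      by (simp add: src.A_zero_mult tgt.A_zero_mult lin_ext_zero lin_ext_closed)
  next
    case (add f f')
    then show ?case using x
      by (simp add: src.A_r_distr tgt.A_r_distr lin_ext_add lin_ext_closed src.A_mult_closed)
  next
    case (single y b)
    then show ?case using x
      by (auto simp: src.lin_ext_single src.single_mult_single tgt.single_mult_single
          map_D map_op lin_ext_zero)
  qed
qed

lemma lin_ext_alg_hom: "lin_ext R h \<in> alg_hom R src.A tgt.A"
  by (auto simp: alg_hom_def lin_ext_closed lin_ext_add lin_ext_mult lin_ext_smult)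

end

section \<open>Congruences and reflexive coequalizers\<close>

text \<open>Compatibility with the operations makes each union in \<open>quotient_alg\<close> a
  union of equal classes, so that it can be computed on representatives.\<close>

locale algebra_congruence = nonunital_algebra R A
  for R :: "('r, 'm) ring_scheme" (structure) and A :: "('r, 'a) module" +
  fixes r :: "('a \<times> 'a) set"
  assumes cong_equiv: "equiv (carrier A) r"
    and cong_add: "\<lbrakk>(p, p') \<in> r; (q, q') \<in> r\<rbrakk> \<Longrightarrow> (p \<oplus>\<^bsub>A\<^esub> q, p' \<oplus>\<^bsub>A\<^esub> q') \<in> r"
    and cong_mult: "\<lbrakk>(p, p') \<in> r; (q, q') \<in> r\<rbrakk> \<Longrightarrow> (p \<otimes>\<^bsub>A\<^esub> q, p' \<otimes>\<^bsub>A\<^esub> q') \<in> r"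
    and cong_smult: "\<lbrakk>c \<in> carrier R; (p, p') \<in> r\<rbrakk> \<Longrightarrow> (c \<odot>\<^bsub>A\<^esub> p, c \<odot>\<^bsub>A\<^esub> p') \<in> r"
begin

lemma quotient_ops:
  assumes "p \<in> carrier A" "q \<in> carrier A"
  shows "r `` {p} \<oplus>\<^bsub>quotient_alg A r\<^esub> r `` {q} = r `` {p \<oplus>\<^bsub>A\<^esub> q}"
    and "r `` {p} \<otimes>\<^bsub>quotient_alg A r\<^esub> r `` {q} = r `` {p \<otimes>\<^bsub>A\<^esub> q}"
proof -
  have "congruent2 r r (\<lambda>p q. r `` {p \<oplus>\<^bsub>A\<^esub> q})" "congruent2 r r (\<lambda>p q. r `` {p \<otimes>\<^bsub>A\<^esub> q})"
    by (auto simp: congruent2_def intro!: equiv_class_eq[OF cong_equiv] cong_add cong_mult)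
  from this[THEN UN_equiv_class2[OF cong_equiv cong_equiv], OF assms]
  show "r `` {p} \<oplus>\<^bsub>quotient_alg A r\<^esub> r `` {q} = r `` {p \<oplus>\<^bsub>A\<^esub> q}"
    and "r `` {p} \<otimes>\<^bsub>quotient_alg A r\<^esub> r `` {q} = r `` {p \<otimes>\<^bsub>A\<^esub> q}"
    by (simp_all add: quotient_alg_def)
qed

lemma quotient_smult:
  assumes "c \<in> carrier R" "p \<in> carrier A"
  shows "c \<odot>\<^bsub>quotient_alg A r\<^esub> r `` {p} = r `` {c \<odot>\<^bsub>A\<^esub> p}"
proof -
  have "congruent r (\<lambda>p. r `` {c \<odot>\<^bsub>A\<^esub> p})"
    using assms by (auto simp: congruent_def intro!: equiv_class_eq[OF cong_equiv] cong_smult)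
  from UN_equiv_class[OF cong_equiv this assms(2)] show ?thesis
    by (simp add: quotient_alg_def)
qed

lemma quotient_carrier: "carrier (quotient_alg A r) = (\<lambda>p. r `` {p}) ` carrier A"
  by (auto simp: quotient_alg_def quotient_def)

lemma quotient_zero: "\<zero>\<^bsub>quotient_alg A r\<^esub> = r `` {\<zero>\<^bsub>A\<^esub>}"
  by (simp add: quotient_alg_def)

lemmas quotient_simps = quotient_ops quotient_smult quotient_carrier quotient_zero

lemma quotient_nonunital_algebra: "nonunital_algebra R (quotient_alg A r)"
proof -
  have "abelian_group (quotient_alg A r)"
  proof (rule abelian_groupI)
    fix P assume "P \<in> carrier (quotient_alg A r)"
    then obtain p where p: "p \<in> carrier A" "P = r `` {p}" by (auto simp: quotient_carrier)
    then show "\<exists>Q\<in>carrier (quotient_alg A r).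
        Q \<oplus>\<^bsub>quotient_alg A r\<^esub> P = \<zero>\<^bsub>quotient_alg A r\<^esub>"
      by (intro bexI[of _ "r `` {\<ominus>\<^bsub>A\<^esub> p}"]) (auto simp: quotient_simps M.l_neg)
  qed (auto simp: quotient_simps M.a_ac)
  then have "module R (quotient_alg A r)"
    by (intro moduleI R.is_cring)
      (auto simp: quotient_simps smult_l_distr smult_r_distr smult_assoc1)
  then show ?thesis
    by (intro nonunital_algebra.intro nonunital_algebra_axioms.intro)
      (auto simp: quotient_simps mult_closed mult_assoc mult_l_distr mult_r_distr
        smult_mult_l smult_mult_r)
qed

lemma quotient_proj_alg_hom: "(\<lambda>p. r `` {p}) \<in> alg_hom R A (quotient_alg A r)"
  by (auto simp: alg_hom_def quotient_simps mult_closed)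

text \<open>Uniqueness holds because every element of the quotient is the class of some element of
  \<open>A\<close>.\<close>

lemma quotient_lift:
  assumes k: "k \<in> alg_hom R A T"
    and resp: "\<And>p q. (p, q) \<in> r \<Longrightarrow> k p = k q"
  shows "\<exists>h\<in>alg_hom R (quotient_alg A r) T. (\<forall>p\<in>carrier A. h (r `` {p}) = k p) \<and>
    (\<forall>h'\<in>alg_hom R (quotient_alg A r) T. (\<forall>p\<in>carrier A. h' (r `` {p}) = k p) \<longrightarrow>
      (\<forall>P\<in>carrier (quotient_alg A r). h' P = h P))"
proof -
  \<comment> \<open>The choice of representative is harmless, since \<open>k\<close> is constant on
    classes.\<close>
  define h where "h P = k (SOME p. p \<in> P)" for P
  have h: "h (r `` {p}) = k p" if "p \<in> carrier A" for p
  proof -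
    have "p \<in> r `` {p}" using equiv_class_self[OF cong_equiv that] .
    then have "(SOME q. q \<in> r `` {p}) \<in> r `` {p}" by (rule someI)
    then show ?thesis using resp by (auto simp: h_def)
  qed
  have "h \<in> alg_hom R (quotient_alg A r) T"
    using k by (auto simp: alg_hom_def quotient_simps h mult_closed)
  then show ?thesis using h by (intro bexI[of _ h]) (auto simp: quotient_carrier)
qed

end

text \<open>\<open>common_section\<close> is pointwise: the preimage may be chosen separately for
  each \<open>y\<close>, and no homomorphism property of the choice is demanded.\<close>

locale reflexive_pair =
  dom: nonunital_algebra R A + cod: nonunital_algebra R B
  for R :: "('r, 'm) ring_scheme" (structure)
    and A :: "('r, 'a) module" and B :: "('r, 'b) module" +
  fixes f g :: "'a \<Rightarrow> 'b"
  assumes f_hom: "f \<in> alg_hom R A B" and g_hom: "g \<in> alg_hom R A B"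
    and common_section: "y \<in> carrier B \<Longrightarrow> \<exists>x\<in>carrier A. f x = y \<and> g x = y"
begin

definition diff_rel :: "('b \<times> 'b) set" where
  "diff_rel = {(p, q). p \<in> carrier B \<and> q \<in> carrier B \<and>
     (\<exists>x\<in>carrier A. p = q \<oplus>\<^bsub>B\<^esub> (f x \<ominus>\<^bsub>B\<^esub> g x))}"

lemma hom_simps:
  assumes "x \<in> carrier A"
  shows "f x \<in> carrier B" "g x \<in> carrier B"
    and "c \<in> carrier R \<Longrightarrow> f (c \<odot>\<^bsub>A\<^esub> x) = c \<odot>\<^bsub>B\<^esub> f x"
    and "c \<in> carrier R \<Longrightarrow> g (c \<odot>\<^bsub>A\<^esub> x) = c \<odot>\<^bsub>B\<^esub> g x"
    and "y \<in> carrier A \<Longrightarrow> f (x \<oplus>\<^bsub>A\<^esub> y) = f x \<oplus>\<^bsub>B\<^esub> f y"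
    and "y \<in> carrier A \<Longrightarrow> g (x \<oplus>\<^bsub>A\<^esub> y) = g x \<oplus>\<^bsub>B\<^esub> g y"
    and "y \<in> carrier A \<Longrightarrow> f (x \<otimes>\<^bsub>A\<^esub> y) = f x \<otimes>\<^bsub>B\<^esub> f y"
    and "y \<in> carrier A \<Longrightarrow> g (x \<otimes>\<^bsub>A\<^esub> y) = g x \<otimes>\<^bsub>B\<^esub> g y"
  using assms f_hom g_hom by (auto simp: alg_hom_def)

text \<open>If \<open>p = q + (f x - g x)\<close> and \<open>y\<close> is sent to \<open>q - g x\<close> by both maps, then \<open>x + y\<close> is sent
  to \<open>p\<close> by \<open>f\<close> and to \<open>q\<close> by \<open>g\<close>.\<close>

lemma diff_rel_eq: "diff_rel = (\<lambda>x. (f x, g x)) ` carrier A"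
proof (intro equalityI subsetI)
  fix w assume "w \<in> diff_rel"
  then obtain p q x where w: "w = (p, q)" "p \<in> carrier B" "q \<in> carrier B" "x \<in> carrier A"
    "p = q \<oplus>\<^bsub>B\<^esub> (f x \<ominus>\<^bsub>B\<^esub> g x)" by (auto simp: diff_rel_def)
  then obtain y where y: "y \<in> carrier A" "f y = q \<ominus>\<^bsub>B\<^esub> g x" "g y = q \<ominus>\<^bsub>B\<^esub> g x"
    using common_section[of "q \<ominus>\<^bsub>B\<^esub> g x"] hom_simps by auto
  have "f (x \<oplus>\<^bsub>A\<^esub> y) = p" "g (x \<oplus>\<^bsub>A\<^esub> y) = q"
    using w y hom_simps(1,2)[OF w(4)]
    by (simp_all add: hom_simps a_minus_def cod.M.a_ac cod.M.r_neg cod.M.r_neg2)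
  then show "w \<in> (\<lambda>x. (f x, g x)) ` carrier A"
    using w y by (intro image_eqI[of _ _ "x \<oplus>\<^bsub>A\<^esub> y"]) auto
next
  fix w assume "w \<in> (\<lambda>x. (f x, g x)) ` carrier A"
  then obtain x where x: "x \<in> carrier A" "w = (f x, g x)" by auto
  then have "f x = g x \<oplus>\<^bsub>B\<^esub> (f x \<ominus>\<^bsub>B\<^esub> g x)"
    using hom_simps(1,2)[OF x(1)] by (simp add: a_minus_def cod.M.a_ac cod.M.r_neg)
  then show "w \<in> diff_rel" using x hom_simps by (auto simp: diff_rel_def)
qed

lemma hom_minus:
  assumes x: "x \<in> carrier A"
  shows "f (\<ominus>\<^bsub>A\<^esub> x) = \<ominus>\<^bsub>B\<^esub> f x" "g (\<ominus>\<^bsub>A\<^esub> x) = \<ominus>\<^bsub>B\<^esub> g x"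
proof -
  have "\<ominus>\<^bsub>A\<^esub> x = (\<ominus> \<one>) \<odot>\<^bsub>A\<^esub> x"
    using x by (simp add: dom.smult_l_minus)
  then show "f (\<ominus>\<^bsub>A\<^esub> x) = \<ominus>\<^bsub>B\<^esub> f x" "g (\<ominus>\<^bsub>A\<^esub> x) = \<ominus>\<^bsub>B\<^esub> g x"
    using x by (simp_all add: hom_simps cod.smult_l_minus)
qed

lemma diff_rel_equiv: "equiv (carrier B) diff_rel"
proof (rule equivI)
  show "diff_rel \<subseteq> carrier B \<times> carrier B" by (auto simp: diff_rel_def)
  show "refl_on (carrier B) diff_rel"
  proof (rule refl_onI)
    fix p assume "p \<in> carrier B"
    then obtain x where "x \<in> carrier A" "f x = p" "g x = p" using common_section by blast
    then show "(p, p) \<in> diff_rel" unfolding diff_rel_eq by force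
  qed
  show "sym diff_rel"
  proof (rule symI)
    fix p q assume "(p, q) \<in> diff_rel"
    then obtain x where x: "x \<in> carrier A" "p = f x" "q = g x" by (auto simp: diff_rel_eq)
    then obtain u v where uv: "u \<in> carrier A" "f u = p" "g u = p" "v \<in> carrier A" "f v = q" "g v = q"
      using common_section[of p] common_section[of q] hom_simps by auto
    \<comment> \<open>This is u - x + v: \<open>f\<close> sends it to p - p + q, and
      \<open>g\<close> sends it to p - q + q.\<close>
    let ?y = "u \<oplus>\<^bsub>A\<^esub> (\<ominus>\<^bsub>A\<^esub> x \<oplus>\<^bsub>A\<^esub> v)"
    have "f ?y = q" "g ?y = p"
      using x uv hom_simps(1,2)[OF x(1)]
      by (simp_all add: hom_simps hom_minus cod.M.r_neg2 cod.M.l_neg)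
    then show "(q, p) \<in> diff_rel"
      unfolding diff_rel_eq using x uv by (intro image_eqI[of _ _ ?y]) auto
  qed
  show "trans diff_rel"
  proof (rule transI)
    fix p q r assume "(p, q) \<in> diff_rel" "(q, r) \<in> diff_rel"
    then obtain x x' where x: "x \<in> carrier A" "p = f x" "q = g x"
      "x' \<in> carrier A" "q = f x'" "r = g x'" by (auto simp: diff_rel_eq)
    then obtain y where y: "y \<in> carrier A" "f y = q" "g y = q"
      using common_section[of q] hom_simps by auto
    have c: "p \<in> carrier B" "q \<in> carrier B" "r \<in> carrier B"
      using x hom_simps by auto
    \<comment> \<open>The witness is x + x' - y, where \<open>y\<close> removes the middle value
      \<open>q\<close>. Each map gets the bracketing in which its two copies of \<open>q\<close>
      cancel directly.\<close>
    have "f (x \<oplus>\<^bsub>A\<^esub> (x' \<oplus>\<^bsub>A\<^esub> \<ominus>\<^bsub>A\<^esub> y)) = p" "g (x' \<oplus>\<^bsub>A\<^esub> (x \<oplus>\<^bsub>A\<^esub> \<ominus>\<^bsub>A\<^esub> y)) = r"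
      using x y c by (simp_all add: hom_simps hom_minus cod.M.r_neg)
    moreover have "x \<oplus>\<^bsub>A\<^esub> (x' \<oplus>\<^bsub>A\<^esub> \<ominus>\<^bsub>A\<^esub> y) = x' \<oplus>\<^bsub>A\<^esub> (x \<oplus>\<^bsub>A\<^esub> \<ominus>\<^bsub>A\<^esub> y)"
      using x y by (simp add: dom.M.a_ac)
    ultimately show "(p, r) \<in> diff_rel"
      unfolding diff_rel_eq using x y
      by (intro image_eqI[of _ _ "x \<oplus>\<^bsub>A\<^esub> (x' \<oplus>\<^bsub>A\<^esub> \<ominus>\<^bsub>A\<^esub> y)"]) auto
  qed
qed

text \<open>In the description by pairs \<open>(f x, g x)\<close>, each operation on pairs comes
  from the same operation on the elements \<open>x\<close>.\<close>

sublocale quot: algebra_congruence R B diff_rel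
proof (unfold_locales)
  show "equiv (carrier B) diff_rel" by (rule diff_rel_equiv)
  fix p p' q q' assume "(p, p') \<in> diff_rel" "(q, q') \<in> diff_rel"
  then obtain x y where *: "x \<in> carrier A" "y \<in> carrier A" "p = f x" "p' = g x" "q = f y" "q' = g y"
    by (auto simp: diff_rel_eq)
  show "(p \<oplus>\<^bsub>B\<^esub> q, p' \<oplus>\<^bsub>B\<^esub> q') \<in> diff_rel"
    unfolding diff_rel_eq using * by (intro image_eqI[of _ _ "x \<oplus>\<^bsub>A\<^esub> y"]) (auto simp: hom_simps)
  show "(p \<otimes>\<^bsub>B\<^esub> q, p' \<otimes>\<^bsub>B\<^esub> q') \<in> diff_rel"
    unfolding diff_rel_eq using *
    by (intro image_eqI[of _ _ "x \<otimes>\<^bsub>A\<^esub> y"]) (auto simp: hom_simps dom.mult_closed)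
next
  fix c p p' assume c: "c \<in> carrier R" and "(p, p') \<in> diff_rel"
  then obtain x where *: "x \<in> carrier A" "p = f x" "p' = g x"
    by (auto simp: diff_rel_eq)
  show "(c \<odot>\<^bsub>B\<^esub> p, c \<odot>\<^bsub>B\<^esub> p') \<in> diff_rel"
    unfolding diff_rel_eq using * c by (intro image_eqI[of _ _ "c \<odot>\<^bsub>A\<^esub> x"]) (auto simp: hom_simps)
qed

lemma diff_rel_coequalizer:
  "is_coequalizer TYPE('t) R A B f g (quotient_alg B diff_rel) (\<lambda>p. diff_rel `` {p})"
  unfolding is_coequalizer_def
proof (intro conjI allI impI ballI; (elim conjE)?)
  show "diff_rel `` {f x} = diff_rel `` {g x}" if "x \<in> carrier A" for x
    using that by (intro equiv_class_eq[OF diff_rel_equiv]) (simp add: diff_rel_eq)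
  fix T :: "('r, 't) module" and k
  assume k: "k \<in> alg_hom R B T" and eq: "\<forall>x\<in>carrier A. k (f x) = k (g x)"
  show "\<exists>h\<in>alg_hom R (quotient_alg B diff_rel) T. (\<forall>p\<in>carrier B. h (diff_rel `` {p}) = k p) \<and>
    (\<forall>h'\<in>alg_hom R (quotient_alg B diff_rel) T. (\<forall>p\<in>carrier B. h' (diff_rel `` {p}) = k p) \<longrightarrow>
      (\<forall>P\<in>carrier (quotient_alg B diff_rel). h' P = h P))"
    by (rule quot.quotient_lift[OF k]) (use eq in \<open>auto simp: diff_rel_eq\<close>)
qed (use f_hom g_hom dom.nonunital_algebra_axioms cod.nonunital_algebra_axioms
    quot.quotient_nonunital_algebra
    quot.quotient_proj_alg_hom in auto)

text \<open>The set on the left is the one of Moore boundaries in degree 0. If \<open>y\<close> is a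
  common preimage of \<open>p\<close>, the involution sending \<open>x\<close> to y - x exchanges
  the elements with f x = 0 and those with f x = p. It also exchanges the conditions - g x = - p + q
  and g x = q, so one witness serves both directions.\<close>

lemma racong_eq_diff_rel:
  "racong\<^bsub>B\<^esub> ((\<lambda>x. \<ominus>\<^bsub>B\<^esub> g x) ` {x \<in> carrier A. f x = \<zero>\<^bsub>B\<^esub>}) = diff_rel"
proof -
  have "(p, q) \<in> racong\<^bsub>B\<^esub> ((\<lambda>x. \<ominus>\<^bsub>B\<^esub> g x) ` {x \<in> carrier A. f x = \<zero>\<^bsub>B\<^esub>}) \<longleftrightarrow>
      (p, q) \<in> diff_rel" for p q
  proof (cases "p \<in> carrier B \<and> q \<in> carrier B")
    case True
    then have c: "p \<in> carrier B" "q \<in> carrier B" by auto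
    then obtain y where y: "y \<in> carrier A" "f y = p" "g y = p" using common_section by blast
    have "(\<exists>x\<in>carrier A. f x = \<zero>\<^bsub>B\<^esub> \<and> \<ominus>\<^bsub>B\<^esub> p \<oplus>\<^bsub>B\<^esub> q = \<ominus>\<^bsub>B\<^esub> g x) \<longleftrightarrow>
      (\<exists>x\<in>carrier A. p = f x \<and> q = g x)"
    proof (safe)
      fix x assume x: "x \<in> carrier A" "f x = \<zero>\<^bsub>B\<^esub>" "\<ominus>\<^bsub>B\<^esub> p \<oplus>\<^bsub>B\<^esub> q = \<ominus>\<^bsub>B\<^esub> g x"
      have "q = p \<oplus>\<^bsub>B\<^esub> \<ominus>\<^bsub>B\<^esub> g x"
        unfolding x(3)[symmetric] using c by (simp add: cod.M.r_neg2)
      then show "\<exists>x\<in>carrier A. p = f x \<and> q = g x"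
        using x(1,2) y c
        by (intro bexI[of _ "y \<oplus>\<^bsub>A\<^esub> \<ominus>\<^bsub>A\<^esub> x"]) (simp_all add: hom_simps hom_minus)
    next
      fix x assume x: "x \<in> carrier A" "p = f x" "q = g x"
      then show "\<exists>z\<in>carrier A. f z = \<zero>\<^bsub>B\<^esub> \<and> \<ominus>\<^bsub>B\<^esub> f x \<oplus>\<^bsub>B\<^esub> g x = \<ominus>\<^bsub>B\<^esub> g z"
        using y c by (intro bexI[of _ "y \<oplus>\<^bsub>A\<^esub> \<ominus>\<^bsub>A\<^esub> x"])
          (simp_all add: hom_simps hom_minus cod.M.r_neg cod.M.minus_add)
    qed
    then show ?thesis
      using c by (auto simp: diff_rel_eq a_r_congruent_def r_congruent_def a_inv_def)
  qed (auto simp: diff_rel_def a_r_congruent_def r_congruent_def)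
  then show ?thesis by auto
qed

end

section \<open>Concatenation and faces of traces\<close>

text \<open>The invariant \<open>P\<close> is for operations that respect a step only under a side
  condition, such as concatenation with a path of matching end point. It must be constant in both
  directions, as \<open>equivclp\<close> also runs steps backwards.\<close>

lemma equivclp_map:
  assumes "equivclp r p q" "P p"
    and inv: "\<And>y z. r y z \<Longrightarrow> P y \<longleftrightarrow> P z"
    and map: "\<And>y z. \<lbrakk>r y z; P y; P z\<rbrakk> \<Longrightarrow> equivclp s (h y) (h z)"
  shows "equivclp s (h p) (h q)"
proof -
  have "P q \<and> equivclp s (h p) (h q)" using assms(1)
  proof (induction rule: equivclp_induct)
    case (step y z)
    then have "P y" "P z" using inv by blast+
    then have "equivclp s (h y) (h z)" using step(2) map by (auto intro: equivclp_sym)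
    with step(3) \<open>P z\<close> show ?case by (auto intro: equivclp_trans)
  qed (use assms(2) in simp)
  then show ?thesis ..
qed

section \<open>Reparametrizations of the unit interval\<close>

definition reparam :: "(real \<Rightarrow> real) \<Rightarrow> bool" where
  "reparam \<phi> \<longleftrightarrow> continuous_on {0..1} \<phi> \<and> mono_on {0..1} \<phi> \<and> \<phi> 0 = 0 \<and> \<phi> 1 = 1"

text \<open>Fixed end points give surjectivity by the intermediate value theorem, and surjectivity
  gives fixed end points by monotonicity. The end point form is the one that explicit formulas
  satisfy at sight.\<close>

lemma reparam_iff:
  "reparam \<phi> \<longleftrightarrow> continuous_on {0..1} \<phi> \<and> mono_on {0..1} \<phi> \<and> \<phi> ` {0..1} = {0..1}"
proof -
  have "\<phi> 0 = 0 \<and> \<phi> 1 = 1 \<longleftrightarrow> \<phi> ` {0..1} = {0..1}"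
    if cont: "continuous_on {0..1} \<phi>" and mono: "mono_on {0..1} \<phi>"
  proof (intro iffI conjI)
    assume *: "\<phi> 0 = 0 \<and> \<phi> 1 = 1"
    have "y \<in> \<phi> ` {0..1}" if "y \<in> {0..1}" for y
      using IVT'[of \<phi> 0 y 1] cont * that by auto
    moreover have "\<phi> s \<in> {0..1}" if "s \<in> {0..1}" for s
      using mono_onD[OF mono, of 0 s] mono_onD[OF mono, of s 1] * that by auto
    ultimately show "\<phi> ` {0..1} = {0..1}" by blast
  next
    assume im: "\<phi> ` {0..1} = {0..1}"
    have "0 \<in> \<phi> ` {0..1}" "1 \<in> \<phi> ` {0..1}" unfolding im by auto
    then obtain u v where uv: "u \<in> {0..1}" "\<phi> u = 0" "v \<in> {0..1}" "\<phi> v = 1"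
      by (elim imageE) auto
    have "\<phi> 0 \<in> \<phi> ` {0..1}" "\<phi> 1 \<in> \<phi> ` {0..1}" by auto
    then have "\<phi> 0 \<in> {0..1}" "\<phi> 1 \<in> {0..1}" unfolding im .
    with uv show "\<phi> 0 = 0" "\<phi> 1 = 1"
      using mono_onD[OF mono, of 0 u] mono_onD[OF mono, of v 1] by auto
  qed
  then show ?thesis unfolding reparam_def by blast
qed

lemma reparam_id: "reparam (\<lambda>s. s)"
  by (auto simp: reparam_def mono_on_def)

lemma reparam_in_unit: "reparam \<phi> \<Longrightarrow> s \<in> {0..1} \<Longrightarrow> \<phi> s \<in> {0..1}"
  unfolding reparam_iff by blast

text \<open>Each half of the interval is mapped to itself by a rescaled copy of \<phi> or \<psi>;
  this is what reparametrizing both factors does to a concatenation.\<close>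

lemma reparam_join:
  assumes "reparam \<phi>" "reparam \<psi>"
  shows "reparam (\<lambda>s. if s \<le> 1 / 2 then \<phi> (2 * s) / 2 else (\<psi> (2 * s - 1) + 1) / 2)"
  unfolding reparam_def
proof (intro conjI)
  have ends: "\<phi> 0 = 0" "\<phi> 1 = 1" "\<psi> 0 = 0" "\<psi> 1 = 1"
    and cont: "continuous_on {0..1} \<phi>" "continuous_on {0..1} \<psi>"
    and mono: "mono_on {0..1} \<phi>" "mono_on {0..1} \<psi>"
    using assms by (auto simp: reparam_def)
  have "continuous_on ({0..1/2} \<union> {1/2..1})
    (\<lambda>s. if s \<le> 1 / 2 then \<phi> (2 * s) / 2 else (\<psi> (2 * s - 1) + 1) / 2)"
  proof (rule continuous_on_If)
    show "continuous_on {0..1/2} (\<lambda>s. \<phi> (2 * s) / 2)"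
      by (intro continuous_intros continuous_on_compose2[OF cont(1)]) auto
    show "continuous_on {1/2..1} (\<lambda>s. (\<psi> (2 * s - 1) + 1) / 2)"
      by (intro continuous_intros continuous_on_compose2[OF cont(2)]) auto
    fix s :: real assume "s \<in> {0..1/2}" "\<not> s \<le> 1 / 2"
    then show "\<phi> (2 * s) / 2 = (\<psi> (2 * s - 1) + 1) / 2" by auto
  next
    fix s :: real assume "s \<in> {1/2..1}" "s \<le> 1 / 2"
    then have s: "s = 1 / 2" by auto
    show "\<phi> (2 * s) / 2 = (\<psi> (2 * s - 1) + 1) / 2" unfolding s by (simp add: ends)
  qed auto
  moreover have "{0..1/2} \<union> {1/2..1} = {0..1::real}" by auto
  ultimately show "continuous_on {0..1}
    (\<lambda>s. if s \<le> 1 / 2 then \<phi> (2 * s) / 2 else (\<psi> (2 * s - 1) + 1) / 2)" by simp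
  show "mono_on {0..1} (\<lambda>s. if s \<le> 1 / 2 then \<phi> (2 * s) / 2 else (\<psi> (2 * s - 1) + 1) / 2)"
  proof (rule mono_onI)
    fix r s :: real assume rs: "r \<in> {0..1}" "s \<in> {0..1}" "r \<le> s"
    \<comment> \<open>In the mixed case the two values are compared through 1/2, the common value of
      both pieces at the midpoint.\<close>
    consider "s \<le> 1 / 2" | "r \<le> 1 / 2" "s > 1 / 2" | "r > 1 / 2" by linarith
    then show "(if r \<le> 1 / 2 then \<phi> (2 * r) / 2 else (\<psi> (2 * r - 1) + 1) / 2)
      \<le> (if s \<le> 1 / 2 then \<phi> (2 * s) / 2 else (\<psi> (2 * s - 1) + 1) / 2)"
    proof cases
      case 1
      then show ?thesis using rs mono_onD[OF mono(1), of "2 * r" "2 * s"] by auto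
    next
      case 2
      then show ?thesis
        using rs mono_onD[OF mono(1), of "2 * r" 1] mono_onD[OF mono(2), of 0 "2 * s - 1"] ends
        by auto
    next
      case 3
      then show ?thesis using rs mono_onD[OF mono(2), of "2 * r - 1" "2 * s - 1"] by auto
    qed
  qed
qed (use assms in \<open>auto simp: reparam_def\<close>)

section \<open>Paths parametrized by a simplex\<close>

lemma continuous_map_simplical_face:
  assumes "1 \<le> n" "j \<le> n"
  shows "continuous_map (simplex_topology (n - 1)) (simplex_topology n) (simplical_face j)"
proof (rule continuous_map_into_subtopology)
  show "simplical_face j \<in> topspace (simplex_topology (n - 1)) \<rightarrow> standard_simplex n"
    using assms simplical_face_in_standard_simplex by auto
  have "continuous_map (powertop_real UNIV) euclideanreal
      (\<lambda>x. if i < j then x i else if i = j then 0 else x (i - 1))" for i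
    by (auto intro: continuous_map_product_projection)
  then show "continuous_map (simplex_topology (n - 1)) (powertop_real UNIV) (simplical_face j)"
    by (simp add: continuous_map_componentwise_UNIV simplical_face_def continuous_map_from_subtopology)
qed

context dspace
begin

lemma reparam_step_iff:
  "reparam_step X dX i p q \<longleftrightarrow>
    p \<in> ipaths X dX i \<and> (\<exists>\<phi>. reparam \<phi> \<and> q = (\<lambda>(s, t)\<in>ipath_dom i. p (\<phi> s, t)))"
  by (auto simp: reparam_step_def reparam_iff)

text \<open>This one statement covers reparametrizations, faces, the two halves of a concatenation,
  and 2-paths constant along the simplex.\<close>

lemma ipath_pullback:
  assumes p: "p \<in> ipaths X dX i"
    and \<phi>: "continuous_on {0..1} \<phi>" "\<phi> ` {0..1} \<subseteq> {0..1}" "mono_on {0..1} \<phi>"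
    and \<tau>: "continuous_map (simplex_topology (k - 1)) (simplex_topology (i - 1)) \<tau>"
  shows "(\<lambda>(s, t)\<in>ipath_dom k. p (\<phi> s, \<tau> t)) \<in> ipaths X dX k"
proof -
  let ?q = "\<lambda>(s, t)\<in>ipath_dom k. p (\<phi> s, \<tau> t)"
  have \<tau>_mem: "\<tau> t \<in> standard_simplex (i - 1)" if "t \<in> standard_simplex (k - 1)" for t
    using continuous_map_image_subset_topspace[OF \<tau>] that by auto
  have "continuous_map (prod_topology (top_of_set {0..1}) (simplex_topology (k - 1)))
      (prod_topology (top_of_set {0..1}) (simplex_topology (i - 1))) (\<lambda>(s, t). (\<phi> s, \<tau> t))"
    using \<phi> \<tau> by (subst continuous_map_prod_top) (auto simp: continuous_map_in_subtopology)
  then have "continuous_map (prod_topology (top_of_set {0..1}) (simplex_topology (k - 1))) X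
      (p \<circ> (\<lambda>(s, t). (\<phi> s, \<tau> t)))"
    using p by (auto simp: ipaths_def intro: continuous_map_compose)
  then have "continuous_map (prod_topology (top_of_set {0..1}) (simplex_topology (k - 1))) X ?q"
    by (rule continuous_map_eq) auto
  moreover have "(\<lambda>s\<in>{0..1}. ?q (s, t)) \<in> dX" if t: "t \<in> standard_simplex (k - 1)" for t
  proof -
    have "(\<lambda>s\<in>{0..1}. p (s, \<tau> t)) \<in> dX"
      using p \<tau>_mem[OF t] by (auto simp: ipaths_def)
    from dpath_reparam[OF this \<phi>] have "(\<lambda>s\<in>{0..1}. (\<lambda>s\<in>{0..1}. p (s, \<tau> t)) (\<phi> s)) \<in> dX" .
    also have "(\<lambda>s\<in>{0..1}. (\<lambda>s\<in>{0..1}. p (s, \<tau> t)) (\<phi> s)) = (\<lambda>s\<in>{0..1}. ?q (s, t))"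
    proof (rule restrict_ext)
      fix s :: real assume "s \<in> {0..1}"
      moreover from this have "\<phi> s \<in> {0..1}" using \<phi>(2) by blast
      ultimately show "(\<lambda>s\<in>{0..1}. p (s, \<tau> t)) (\<phi> s) = ?q (s, t)" using t by simp
    qed
    finally show ?thesis .
  qed
  ultimately show ?thesis by (auto simp: ipaths_def)
qed

lemma ipath_reparam:
  assumes "p \<in> ipaths X dX i" "reparam \<phi>"
  shows "(\<lambda>(s, t)\<in>ipath_dom i. p (\<phi> s, t)) \<in> ipaths X dX i"
  using ipath_pullback[OF assms(1), of \<phi> i "\<lambda>t. t"] assms(2) by (simp add: reparam_iff)

lemma ipath_face_ipaths:
  assumes "p \<in> ipaths X dX (Suc i)" "1 \<le> i" "j \<le> i"
  shows "ipath_face i j p \<in> ipaths X dX i"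
  using ipath_pullback[OF assms(1), of "\<lambda>s. s" i "simplical_face j"]
    continuous_map_simplical_face[OF assms(2,3)]
  by (simp add: ipath_face_def mono_on_def)

lemma ipath_face_between:
  assumes "p \<in> ipaths_between X dX (Suc i) a b" "1 \<le> i" "j \<le> i"
  shows "ipath_face i j p \<in> ipaths_between X dX i a b"
proof -
  have "ipath_face i j p \<in> ipaths X dX i"
    using assms by (intro ipath_face_ipaths) (auto simp: ipaths_between_def)
  moreover have "simplical_face j t \<in> standard_simplex i" if "t \<in> standard_simplex (i - 1)" for t
    using simplical_face_in_standard_simplex assms that by auto
  ultimately show ?thesis
    using assms(1) by (auto simp: ipaths_between_def ipath_face_def)
qed

lemma ipath_concat_between:
  assumes p: "p \<in> ipaths_between X dX i a b" and q: "q \<in> ipaths_between X dX i b c"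
  shows "ipath_concat i p q \<in> ipaths_between X dX i a c"
proof -
  let ?T = "prod_topology (top_of_set {0..1}) (simplex_topology (i - 1))"
  \<comment> \<open>Clamping makes \<open>p\<close> wait at its end and \<open>q\<close> at its
    start, so both become continuous on the whole domain. They agree at time 1/2, with value
    \<open>b\<close>, and can be pasted there.\<close>
  let ?p = "\<lambda>(s, t)\<in>ipath_dom i. p (min (2 * s) 1, t)"
  let ?q = "\<lambda>(s, t)\<in>ipath_dom i. q (max (2 * s - 1) 0, t)"
  have "continuous_on {0..1} (\<lambda>s::real. min (2 * s) 1)"
    "continuous_on {0..1} (\<lambda>s::real. max (2 * s - 1) 0)"
    by (intro continuous_intros)+
  note cont = this
  have "?p \<in> ipaths X dX i"
    by (rule ipath_pullback[where \<tau> = "\<lambda>t. t" and i = i, OF _ cont(1)])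
      (use p in \<open>auto simp: ipaths_between_def mono_on_def\<close>)
  then have contp: "continuous_map ?T X ?p" by (simp add: ipaths_def)
  have "?q \<in> ipaths X dX i"
    by (rule ipath_pullback[where \<tau> = "\<lambda>t. t" and i = i, OF _ cont(2)])
      (use q in \<open>auto simp: ipaths_between_def mono_on_def\<close>)
  then have contq: "continuous_map ?T X ?q" by (simp add: ipaths_def)
  have "continuous_map ?T X (\<lambda>x. if fst x \<le> 1 / 2 then ?p x else ?q x)"
  proof (rule continuous_map_cases_le)
    show "continuous_map ?T euclideanreal fst"
      by (rule continuous_map_into_fulltopology[OF continuous_map_fst])
    fix x :: "real \<times> (nat \<Rightarrow> real)" assume "x \<in> topspace ?T" "fst x = 1 / 2"
    then obtain t where "x = (1 / 2, t)" "t \<in> standard_simplex (i - 1)" by (cases x) auto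
    then show "?p x = ?q x" using p q by (simp add: ipaths_between_def)
  next
    show "continuous_map (subtopology ?T {x \<in> topspace ?T. fst x \<le> 1 / 2}) X ?p"
      by (rule continuous_map_from_subtopology[OF contp])
  next
    show "continuous_map (subtopology ?T {x \<in> topspace ?T. 1 / 2 \<le> fst x}) X ?q"
      by (rule continuous_map_from_subtopology[OF contq])
  qed simp
  then have "continuous_map ?T X (ipath_concat i p q)"
    by (rule continuous_map_eq) (auto simp: ipath_concat_def)
  moreover have "(\<lambda>s\<in>{0..1}. ipath_concat i p q (s, t)) \<in> dX"
    if t: "t \<in> standard_simplex (i - 1)" for t
  proof -
    have "(\<lambda>s\<in>{0..1}. p (s, t)) \<in> dX" "(\<lambda>s\<in>{0..1}. q (s, t)) \<in> dX" "p (1, t) = q (0, t)"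
      using p q t by (auto simp: ipaths_between_def ipaths_def)
    from dpath_concat[OF this(1,2)] this(3)
    have "(\<lambda>s\<in>{0..1}. if s \<le> 1 / 2 then (\<lambda>s\<in>{0..1}. p (s, t)) (2 * s)
      else (\<lambda>s\<in>{0..1}. q (s, t)) (2 * s - 1)) \<in> dX" by simp
    also have "(\<lambda>s\<in>{0..1}. if s \<le> 1 / 2 then (\<lambda>s\<in>{0..1}. p (s, t)) (2 * s)
      else (\<lambda>s\<in>{0..1}. q (s, t)) (2 * s - 1)) = (\<lambda>s\<in>{0..1}. ipath_concat i p q (s, t))"
      using t by (intro restrict_ext) (auto simp: ipath_concat_def)
    finally show ?thesis .
  qed
  moreover have "ipath_concat i p q \<in> extensional (ipath_dom i)"
    by (simp add: ipath_concat_def)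
  ultimately show ?thesis
    using p q by (auto simp: ipaths_between_def ipaths_def ipath_concat_def)
qed

lemma reparam_step_between_iff:
  assumes "reparam_step X dX i p q"
  shows "p \<in> ipaths_between X dX i a b \<longleftrightarrow> q \<in> ipaths_between X dX i a b"
proof -
  obtain \<phi> where p: "p \<in> ipaths X dX i" and \<phi>: "reparam \<phi>"
    and q: "q = (\<lambda>(s, t)\<in>ipath_dom i. p (\<phi> s, t))"
    using assms by (auto simp: reparam_step_iff)
  have "q \<in> ipaths X dX i" unfolding q by (rule ipath_reparam[OF p \<phi>])
  with p \<phi> show ?thesis by (auto simp: ipaths_between_def q reparam_def)
qed

lemma equiv_ipaths_between:
  assumes "equivclp (reparam_step X dX i) p q" "p \<in> ipaths_between X dX i a b"
  shows "q \<in> ipaths_between X dX i a b"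
  using assms by (induction rule: equivclp_induct) (auto simp: reparam_step_between_iff)

section \<open>Traces and their end points\<close>

lemma trace_class_eq_iff:
  "trace_class X dX i p = trace_class X dX i q \<longleftrightarrow> equivclp (reparam_step X dX i) p q"
  by (auto simp: trace_class_def set_eq_iff intro: equivclp_sym equivclp_trans)

lemma trace_class_self: "p \<in> trace_class X dX i p"
  by (simp add: trace_class_def)

lemma traces_between_classI:
  "p \<in> ipaths_between X dX i a b \<Longrightarrow> trace_class X dX i p \<in> traces_between X dX i a b"
  by (simp add: traces_between_def)

lemma traces_between_memD:
  assumes "P \<in> traces_between X dX i a b" "p \<in> P"
  shows "p \<in> ipaths_between X dX i a b" "P = trace_class X dX i p"
proof -
  obtain p' where p': "p' \<in> ipaths_between X dX i a b" "P = trace_class X dX i p'"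
    using assms(1) by (auto simp: traces_between_def)
  then have eq: "equivclp (reparam_step X dX i) p' p" using assms(2) by (simp add: trace_class_def)
  show "p \<in> ipaths_between X dX i a b" using equiv_ipaths_between[OF eq p'(1)] .
  show "P = trace_class X dX i p" using eq p'(2) by (simp add: trace_class_eq_iff)
qed

lemma traces_betweenE:
  assumes "P \<in> traces_between X dX i a b"
  obtains p where "p \<in> ipaths_between X dX i a b" "p \<in> P" "P = trace_class X dX i p"
  using assms trace_class_self by (auto simp: traces_between_def)

lemma ipaths_between_unique:
  assumes "p \<in> ipaths_between X dX i a b" "p \<in> ipaths_between X dX i a' b'"
  shows "a = a'" "b = b'"
  using assms nonempty_standard_simplex[of "i - 1"] by (auto simp: ipaths_between_def)

lemma traces_between_unique:
  assumes "P \<in> traces_between X dX i a b" "P \<in> traces_between X dX i a' b'"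
  shows "a = a'" "b = b'"
proof -
  obtain p where p: "p \<in> P" using assms(1) traces_betweenE by blast
  from assms[THEN traces_between_memD(1), OF p] show "a = a'" "b = b'"
    using ipaths_between_unique by blast+
qed

text \<open>End points lie in the space automatically: the simplex has a point, and they are values
  there of a path with image in the space.\<close>

lemma traces_iff: "P \<in> traces X dX i \<longleftrightarrow> (\<exists>a b. P \<in> traces_between X dX i a b)"
proof
  assume "\<exists>a b. P \<in> traces_between X dX i a b"
  then obtain a b where P: "P \<in> traces_between X dX i a b" by blast
  then obtain p where p: "p \<in> ipaths_between X dX i a b" by (rule traces_betweenE)
  obtain t where t: "t \<in> standard_simplex (i - 1)" using nonempty_standard_simplex by blast
  have "p ` ipath_dom i \<subseteq> topspace X"
    using p continuous_map_image_subset_topspace[of _ X p]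
    by (fastforce simp: ipaths_between_def ipaths_def)
  then have "p (0, t) \<in> topspace X" "p (1, t) \<in> topspace X" using t by auto
  then have "a \<in> topspace X" "b \<in> topspace X" using p t by (auto simp: ipaths_between_def)
  with P show "P \<in> traces X dX i" by (auto simp: traces_def)
qed (auto simp: traces_def)

lemma composable_iff:
  assumes "P \<in> traces_between X dX i a b" "Q \<in> traces_between X dX i c d"
  shows "composable X dX i P Q \<longleftrightarrow> b = c"
  using assms traces_between_unique unfolding composable_def by metis

section \<open>Concatenation and faces on trace classes\<close>

lemma reparam_step_refl: "p \<in> ipaths X dX i \<Longrightarrow> reparam_step X dX i p p"
  unfolding reparam_step_iff
  by (intro conjI exI[of _ "\<lambda>s. s"]) (auto simp: reparam_id ipaths_def extensional_def)

lemma reparam_step_concat: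
  assumes "reparam_step X dX i p p'" "reparam_step X dX i q q'"
    and "p \<in> ipaths_between X dX i a b" "q \<in> ipaths_between X dX i b c"
  shows "reparam_step X dX i (ipath_concat i p q) (ipath_concat i p' q')"
proof -
  obtain \<phi> \<psi> where \<phi>: "reparam \<phi>" "p' = (\<lambda>(s, t)\<in>ipath_dom i. p (\<phi> s, t))"
    and \<psi>: "reparam \<psi>" "q' = (\<lambda>(s, t)\<in>ipath_dom i. q (\<psi> s, t))"
    using assms by (auto simp: reparam_step_iff)
  let ?\<chi> = "\<lambda>s. if s \<le> 1 / 2 then \<phi> (2 * s) / 2 else (\<psi> (2 * s - 1) + 1) / 2"
  have "ipath_concat i p' q' (s, t) = ipath_concat i p q (?\<chi> s, t)"
    if st: "s \<in> {0..1}" "t \<in> standard_simplex (i - 1)" for s t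
  proof (cases "s \<le> 1 / 2")
    case True
    then have "\<phi> (2 * s) \<in> {0..1}" using reparam_in_unit[OF \<phi>(1), of "2 * s"] st by auto
    then show ?thesis using True st by (auto simp: ipath_concat_def \<phi>)
  next
    case False
    then have *: "\<psi> (2 * s - 1) \<in> {0..1}" using reparam_in_unit[OF \<psi>(1), of "2 * s - 1"] st by auto
    \<comment> \<open>If \<open>\<psi> (2 * s - 1)\<close> is 0, then \<open>?\<chi> s\<close> is
      exactly 1/2, where \<open>ipath_concat\<close> takes its first branch and reads
      \<open>p\<close> instead of \<open>q\<close>.\<close>
    moreover have "p (1, t) = q (0, t)" using assms(3,4) st by (simp add: ipaths_between_def)
    ultimately show ?thesis using False st by (auto simp: ipath_concat_def \<psi> field_simps)
  qed
  then have "ipath_concat i p' q' = (\<lambda>(s, t)\<in>ipath_dom i. ipath_concat i p q (?\<chi> s, t))"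
    by (intro extensionalityI[of _ "ipath_dom i"]) (auto simp: ipath_concat_def)
  moreover have "ipath_concat i p q \<in> ipaths X dX i"
    using ipath_concat_between[OF assms(3,4)] by (simp add: ipaths_between_def)
  ultimately show ?thesis
    using reparam_join[OF \<phi>(1) \<psi>(1)] unfolding reparam_step_iff by blast
qed

text \<open>The zigzags of steps for \<open>p\<close> and for \<open>q\<close> may differ in length
  and direction, so one factor is moved at a time while the other makes a reflexive step.\<close>

lemma equiv_concat:
  assumes "equivclp (reparam_step X dX i) p p'" "equivclp (reparam_step X dX i) q q'"
    and p: "p \<in> ipaths_between X dX i a b" and q: "q \<in> ipaths_between X dX i b c"
  shows "equivclp (reparam_step X dX i) (ipath_concat i p q) (ipath_concat i p' q')"
proof -
  have p': "p' \<in> ipaths_between X dX i a b" using equiv_ipaths_between[OF assms(1) p] .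
  have refl: "reparam_step X dX i q q" "reparam_step X dX i p' p'"
    using p' q by (auto intro!: reparam_step_refl simp: ipaths_between_def)
  have "equivclp (reparam_step X dX i) (ipath_concat i p q) (ipath_concat i p' q)"
    using assms(1) p by (rule equivclp_map[where P = "\<lambda>p. p \<in> ipaths_between X dX i a b"])
      (use reparam_step_between_iff reparam_step_concat[OF _ refl(1) _ q] in blast)+
  also have "equivclp (reparam_step X dX i) (ipath_concat i p' q) (ipath_concat i p' q')"
    using assms(2) q by (rule equivclp_map[where P = "\<lambda>q. q \<in> ipaths_between X dX i b c"])
      (use reparam_step_between_iff reparam_step_concat[OF refl(2) _ p'] in blast)+
  finally (equivclp_trans) show ?thesis .
qed

lemma trace_concat_class:
  assumes "p \<in> ipaths_between X dX i a b" "q \<in> ipaths_between X dX i b c"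
  shows "trace_concat X dX i (trace_class X dX i p) (trace_class X dX i q) =
    trace_class X dX i (ipath_concat i p q)"
proof -
  have "trace_class X dX i (ipath_concat i p' q') = trace_class X dX i (ipath_concat i p q)"
    if "p' \<in> trace_class X dX i p" "q' \<in> trace_class X dX i q" for p' q'
    using equiv_concat[OF _ _ assms, of p' q'] that
    by (auto simp: trace_class_def[of X dX _ p] trace_class_def[of X dX _ q] trace_class_eq_iff intro: equivclp_sym)
  then show ?thesis
    unfolding trace_concat_def using trace_class_self by blast
qed

text \<open>Faces act on the simplex coordinate and reparametrizations on time, so the two
  commute.\<close>

lemma equiv_face:
  assumes "equivclp (reparam_step X dX (Suc i)) p q" "1 \<le> i" "j \<le> i"
  shows "equivclp (reparam_step X dX i) (ipath_face i j p) (ipath_face i j q)"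
proof -
  have face: "simplical_face j t \<in> standard_simplex i" if "t \<in> standard_simplex (i - 1)" for t
    using simplical_face_in_standard_simplex assms that by auto
  have step: "reparam_step X dX i (ipath_face i j y) (ipath_face i j z)"
    if yz: "reparam_step X dX (Suc i) y z" for y z
  proof -
    obtain \<phi> where y: "y \<in> ipaths X dX (Suc i)" and \<phi>: "reparam \<phi>"
      and z: "z = (\<lambda>(s, t)\<in>ipath_dom (Suc i). y (\<phi> s, t))"
      using yz by (auto simp: reparam_step_iff)
    have "ipath_face i j z = (\<lambda>(s, t)\<in>ipath_dom i. ipath_face i j y (\<phi> s, t))"
      by (intro extensionalityI[of _ "ipath_dom i"])
        (use face reparam_in_unit[OF \<phi>] in \<open>auto simp: ipath_face_def z\<close>)
    then show ?thesis
      using ipath_face_ipaths[OF y assms(2,3)] \<phi> unfolding reparam_step_iff by blast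
  qed
  show ?thesis
    using assms(1) by (rule equivclp_map[where P = "\<lambda>_. True"]) (use step in blast)+
qed

lemma trace_face_class:
  assumes "1 \<le> i" "j \<le> i"
  shows "trace_face X dX i j (trace_class X dX (Suc i) p) = trace_class X dX i (ipath_face i j p)"
proof -
  have "trace_class X dX i (ipath_face i j p') = trace_class X dX i (ipath_face i j p)"
    if "p' \<in> trace_class X dX (Suc i) p" for p'
    using equiv_face[OF _ assms, of p p'] that
    by (auto simp: trace_class_def[of X dX _ p] trace_class_def[of X dX _ q] trace_class_eq_iff intro: equivclp_sym)
  then show ?thesis
    unfolding trace_face_def using trace_class_self by blast
qed

lemma trace_concat_between:
  assumes "P \<in> traces_between X dX i a b" "Q \<in> traces_between X dX i b c"
  shows "trace_concat X dX i P Q \<in> traces_between X dX i a c"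
  using assms by (auto elim!: traces_betweenE
      simp: trace_concat_class intro!: traces_between_classI ipath_concat_between)

lemma trace_face_between:
  assumes "P \<in> traces_between X dX (Suc i) a b" "1 \<le> i" "j \<le> i"
  shows "trace_face X dX i j P \<in> traces_between X dX i a b"
  using assms by (auto elim!: traces_betweenE
      simp: trace_face_class intro!: traces_between_classI ipath_face_between)

lemma trace_face_concat:
  assumes "P \<in> traces_between X dX (Suc i) a b" "Q \<in> traces_between X dX (Suc i) b c"
    and i: "1 \<le> i" "j \<le> i"
  shows "trace_face X dX i j (trace_concat X dX (Suc i) P Q) =
    trace_concat X dX i (trace_face X dX i j P) (trace_face X dX i j Q)"
proof -
  obtain p q where p: "p \<in> ipaths_between X dX (Suc i) a b" "P = trace_class X dX (Suc i) p"
    and q: "q \<in> ipaths_between X dX (Suc i) b c" "Q = trace_class X dX (Suc i) q"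
    using assms by (elim traces_betweenE) blast
  have face: "simplical_face j t \<in> standard_simplex i" if "t \<in> standard_simplex (i - 1)" for t
    using simplical_face_in_standard_simplex i that by auto
  have "ipath_face i j (ipath_concat (Suc i) p q) =
      ipath_concat i (ipath_face i j p) (ipath_face i j q)"
    by (intro extensionalityI[of _ "ipath_dom i"])
      (use face in \<open>auto simp: ipath_face_def ipath_concat_def\<close>)
  then show ?thesis
    by (simp add: p q trace_concat_class[OF p(1) q(1)] trace_face_class[OF i]
        trace_concat_class[OF ipath_face_between[OF p(1) i] ipath_face_between[OF q(1) i]])
qed

lemma ipath_concat_assoc_step:
  assumes p: "p \<in> ipaths_between X dX i a b" and q: "q \<in> ipaths_between X dX i b c"
    and r: "r \<in> ipaths_between X dX i c d"
  shows "reparam_step X dX i (ipath_concat i p (ipath_concat i q r))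
    (ipath_concat i (ipath_concat i p q) r)"
proof -
  \<comment> \<open>The piecewise linear map taking the breaks 0, 1/4, 1/2, 1 of the left bracketing
    to the breaks 0, 1/2, 3/4, 1 of the right one. It is concave, hence the minimum of its three
    linear pieces, which gives continuity and monotonicity at once.\<close>
  let ?\<phi> = "\<lambda>s::real. min (2 * s) (min (s + 1 / 4) ((s + 1) / 2))"
  have "continuous_on {0..1} ?\<phi>" by (intro continuous_intros) simp
  moreover have "mono_on {0..1} ?\<phi>" by (intro mono_onI min.mono) auto
  ultimately have "reparam ?\<phi>" by (auto simp: reparam_def)
  moreover have "ipath_concat i p (ipath_concat i q r) \<in> ipaths X dX i"
    using ipath_concat_between[OF p ipath_concat_between[OF q r]] by (simp add: ipaths_between_def)
  moreover have "ipath_concat i (ipath_concat i p q) r (s, t) =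
      ipath_concat i p (ipath_concat i q r) (?\<phi> s, t)"
    if st: "s \<in> {0..1}" "t \<in> standard_simplex (i - 1)" for s t
  proof -
    consider "s \<le> 1 / 4" | "s > 1 / 4" "s \<le> 1 / 2" | "s > 1 / 2" by linarith
    then show ?thesis
    proof cases
      case 1
      then have "?\<phi> s = 2 * s" by (auto simp: min_def)
      with 1 st show ?thesis by (simp add: ipath_concat_def)
    next
      case 2
      then have "?\<phi> s = s + 1 / 4" by (auto simp: min_def)
      with 2 st show ?thesis by (simp add: ipath_concat_def algebra_simps)
    next
      case 3
      then have "?\<phi> s = (s + 1) / 2" by (auto simp: min_def)
      with 3 st show ?thesis by (simp add: ipath_concat_def field_simps)
    qed
  qed
  then have "ipath_concat i (ipath_concat i p q) r =
      (\<lambda>(s, t)\<in>ipath_dom i. ipath_concat i p (ipath_concat i q r) (?\<phi> s, t))"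
    by (intro extensionalityI[of _ "ipath_dom i"]) (auto simp: ipath_concat_def)
  ultimately show ?thesis unfolding reparam_step_iff by blast
qed

lemma trace_concat_assoc:
  assumes "P \<in> traces_between X dX i a b" "Q \<in> traces_between X dX i b c"
    and "S \<in> traces_between X dX i c d"
  shows "trace_concat X dX i (trace_concat X dX i P Q) S =
    trace_concat X dX i P (trace_concat X dX i Q S)"
proof -
  obtain p q r where p: "p \<in> ipaths_between X dX i a b" "P = trace_class X dX i p"
    and q: "q \<in> ipaths_between X dX i b c" "Q = trace_class X dX i q"
    and r: "r \<in> ipaths_between X dX i c d" "S = trace_class X dX i r"
    using assms by (elim traces_betweenE) blast
  have "trace_class X dX i (ipath_concat i (ipath_concat i p q) r) =
      trace_class X dX i (ipath_concat i p (ipath_concat i q r))"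
    using ipath_concat_assoc_step[OF p(1) q(1) r(1)]
    by (auto simp: trace_class_eq_iff)
  then show ?thesis
    using p q r by (simp add: trace_concat_class[where a = a and b = b and c = c]
        trace_concat_class[where a = b and b = c and c = d]
        trace_concat_class[where a = a and b = c and c = d]
        trace_concat_class[where a = a and b = b and c = d] ipath_concat_between)
qed

lemma trace_face_section:
  assumes "P \<in> traces X dX 1"
  shows "\<exists>Q\<in>traces X dX 2. \<forall>j\<le>1. trace_face X dX 1 j Q = P"
proof -
  obtain a b p where p: "p \<in> ipaths_between X dX 1 a b" "P = trace_class X dX 1 p"
    using assms unfolding traces_iff by (elim exE traces_betweenE) blast
  define e :: "nat \<Rightarrow> real" where "e = (\<lambda>j. if j = 0 then 1 else 0)"
  have e: "standard_simplex 0 = {e}" by (simp add: standard_simplex_0 e_def)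
  \<comment> \<open>This is the degenerate 2-path of \<open>p\<close>: the 1-simplex collapses to
    the only point \<open>e\<close> of the 0-simplex. Restricting it to either vertex returns
    \<open>p\<close> itself.\<close>
  define q where "q = (\<lambda>(s, t)\<in>ipath_dom 2. p (s, e))"
  have "q \<in> ipaths X dX 2"
    unfolding q_def using p e
    by (intro ipath_pullback[where \<phi> = "\<lambda>s. s" and \<tau> = "\<lambda>t. e" and i = 1])
      (auto simp: ipaths_between_def mono_on_def)
  then have q: "q \<in> ipaths_between X dX 2 a b"
    using p by (auto simp: ipaths_between_def q_def e)
  have "trace_face X dX 1 j (trace_class X dX 2 q) = P" if j: "j \<le> 1" for j
  proof -
    have "simplical_face j e \<in> standard_simplex 1"
      using simplical_face_in_standard_simplex[of 1 j e] j e by auto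
    then have "ipath_face 1 j q = p"
      by (intro extensionalityI[of _ "ipath_dom 1"])
        (use p in \<open>auto simp: ipath_face_def q_def e ipaths_between_def ipaths_def\<close>)
    then show ?thesis
      using trace_face_class[of 1 j q] j p by (simp add: numeral_2_eq_2)
  qed
  then show ?thesis
    using q traces_iff traces_between_classI by blast
qed

end

section \<open>The first homology algebra\<close>

context dspace
begin

lemma partial_semigroup_traces:
  "partial_semigroup (traces X dX i) (composable X dX i) (trace_concat X dX i)"
proof
  fix P Q assume "P \<in> traces X dX i" "Q \<in> traces X dX i" "composable X dX i P Q"
  then show "trace_concat X dX i P Q \<in> traces X dX i"
    unfolding composable_def traces_iff using trace_concat_between by blast
next
  fix P Q S assume "P \<in> traces X dX i" "Q \<in> traces X dX i" "S \<in> traces X dX i"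
  then obtain a b c d e f where P: "P \<in> traces_between X dX i a b"
    and Q: "Q \<in> traces_between X dX i c d" and S: "S \<in> traces_between X dX i e f"
    unfolding traces_iff by blast
  have PQ: "composable X dX i P Q \<longleftrightarrow> b = c" and QS: "composable X dX i Q S \<longleftrightarrow> d = e"
    using composable_iff P Q S by blast+
  \<comment> \<open>The concatenation is known to be a trace with end point \<open>d\<close> only
    when \<open>P\<close> and \<open>Q\<close> match. With this proviso both bracketings amount to b
    = c and d = e.\<close>
  have PQ_S: "composable X dX i (trace_concat X dX i P Q) S \<longleftrightarrow> d = e" if "b = c"
    using composable_iff[OF _ S] trace_concat_between[OF P] Q that by blast
  have P_QS: "composable X dX i P (trace_concat X dX i Q S) \<longleftrightarrow> b = c" if "d = e"
    using composable_iff[OF P] trace_concat_between[OF Q] S that by blast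
  show "composable X dX i P Q \<and> composable X dX i (trace_concat X dX i P Q) S \<longleftrightarrow>
      composable X dX i Q S \<and> composable X dX i P (trace_concat X dX i Q S)"
    using PQ QS PQ_S P_QS by blast
  assume "composable X dX i P Q" "composable X dX i (trace_concat X dX i P Q) S"
  then have "b = c" "d = e" using PQ PQ_S by auto
  then show "trace_concat X dX i (trace_concat X dX i P Q) S =
      trace_concat X dX i P (trace_concat X dX i Q S)"
    using trace_concat_assoc P Q S by blast
qed

text \<open>Faces keep start and end points, so composability is both preserved and
  reflected.\<close>

lemma free_partial_alg_map_trace_face:
  assumes "cring R" "1 \<le> i" "j \<le> i"
  shows "free_partial_alg_map R
    (traces X dX (Suc i)) (composable X dX (Suc i)) (trace_concat X dX (Suc i))
    (traces X dX i) (composable X dX i) (trace_concat X dX i) (trace_face X dX i j)"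
proof (intro free_partial_alg_map.intro free_partial_alg.intro partial_semigroup_traces assms(1)
    free_partial_alg_map_axioms.intro)
  fix P assume "P \<in> traces X dX (Suc i)"
  then show "trace_face X dX i j P \<in> traces X dX i"
    unfolding traces_iff using trace_face_between assms by blast
next
  fix P Q assume "P \<in> traces X dX (Suc i)" "Q \<in> traces X dX (Suc i)"
  then obtain a b c d where P: "P \<in> traces_between X dX (Suc i) a b"
    and Q: "Q \<in> traces_between X dX (Suc i) c d"
    unfolding traces_iff by blast
  show *: "composable X dX i (trace_face X dX i j P) (trace_face X dX i j Q) \<longleftrightarrow>
      composable X dX (Suc i) P Q"
    using composable_iff[OF P Q]
      composable_iff[OF trace_face_between[OF P assms(2,3)] trace_face_between[OF Q assms(2,3)]]
    by simp
  assume "composable X dX (Suc i) P Q"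
  then have "b = c" using composable_iff[OF P Q] by simp
  then show "trace_face X dX i j (trace_concat X dX (Suc i) P Q) =
      trace_concat X dX i (trace_face X dX i j P) (trace_face X dX i j Q)"
    using trace_face_concat[OF P _ assms(2,3)] Q by blast
qed

lemma reflexive_pair_trace_faces:
  assumes "cring R"
  shows "reflexive_pair R (trace_alg R X dX 2) (trace_alg R X dX 1)
    (trace_face_lin R X dX 1 0) (trace_face_lin R X dX 1 1)"
proof -
  interpret f: free_partial_alg_map R
    "traces X dX 2" "composable X dX 2" "trace_concat X dX 2"
    "traces X dX 1" "composable X dX 1" "trace_concat X dX 1" "trace_face X dX 1 0"
    using free_partial_alg_map_trace_face[OF assms, of 1 0] by (simp add: numeral_2_eq_2)
  interpret g: free_partial_alg_map R
    "traces X dX 2" "composable X dX 2" "trace_concat X dX 2"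
    "traces X dX 1" "composable X dX 1" "trace_concat X dX 1" "trace_face X dX 1 1"
    using free_partial_alg_map_trace_face[OF assms, of 1 1] by (simp add: numeral_2_eq_2)
  \<comment> \<open>A generator lifts to its degenerate 2-trace with the same coefficient, and sums
    lift by additivity of both faces.\<close>
  have sect: "\<exists>x\<in>carrier f.src.A. lin_ext R (trace_face X dX 1 0) x = y \<and>
      lin_ext R (trace_face X dX 1 1) x = y" if "y \<in> carrier f.tgt.A" for y
    using that
  proof (induction rule: f.tgt.free_induct)
    case zero
    show ?case
      using f.src.A_zero_closed f.lin_ext_zero g.lin_ext_zero by blast
  next
    case (single P c)
    then obtain Q where "Q \<in> traces X dX 2" "\<forall>j\<le>1. trace_face X dX 1 j Q = P"
      using trace_face_section by blast
    then show ?case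
      using single f.src.single_closed
      by (intro bexI[of _ "single R Q c"]) (auto simp: f.src.lin_ext_single)
  next
    case (add y z)
    then obtain u v where "u \<in> carrier f.src.A" "v \<in> carrier f.src.A"
      "lin_ext R (trace_face X dX 1 0) u = y" "lin_ext R (trace_face X dX 1 1) u = y"
      "lin_ext R (trace_face X dX 1 0) v = z" "lin_ext R (trace_face X dX 1 1) v = z"
      by blast
    then show ?case
      by (intro bexI[of _ "u \<oplus>\<^bsub>f.src.A\<^esub> v"])
        (simp_all only: f.lin_ext_add g.lin_ext_add f.src.A_add_closed simp_thms)
  qed
  show ?thesis
    unfolding trace_alg_def trace_face_lin_def
    by (intro reflexive_pair.intro reflexive_pair_axioms.intro f.src.nonunital_algebra_A
        f.tgt.nonunital_algebra_A f.lin_ext_alg_hom g.lin_ext_alg_hom sect)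
qed

end

text \<open>The differential out of degree 0 is zero, so everything there is a cycle. In degree 1
  the only face required to vanish is \<open>face S 1 0\<close>, and the odd degree puts the minus
  sign on \<open>face S 1 1\<close>.\<close>

lemma moore_homology_0:
  "moore_homology S 0 = quotient_alg (obj S 0) (racong\<^bsub>obj S 0\<^esub>
     ((\<lambda>x. \<ominus>\<^bsub>obj S 0\<^esub> face S 1 1 x) ` {x \<in> carrier (obj S 1). face S 1 0 x = \<zero>\<^bsub>obj S 0\<^esub>}))"
proof -
  have "moore_cycles S 0 = obj S 0"
    by (simp add: moore_cycles_def moore_carrier_def moore_diff_def)
  moreover have "moore_boundaries S 0 =
      (\<lambda>x. \<ominus>\<^bsub>obj S 0\<^esub> face S 1 1 x) ` {x \<in> carrier (obj S 1). face S 1 0 x = \<zero>\<^bsub>obj S 0\<^esub>}"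
    by (auto simp: moore_boundaries_def moore_carrier_def moore_diff_def)
  ultimately show ?thesis by (simp add: moore_homology_def)
qed

theorem lemma6:
  fixes R :: "('r, 'm) ring_scheme" and X :: "'a topology" and dX :: "(real \<Rightarrow> 'a) set"
  assumes "cring R" and "dspace X dX"
  shows "is_coequalizer TYPE('t) R (trace_alg R X dX 2) (trace_alg R X dX 1)
           (trace_face_lin R X dX 1 0) (trace_face_lin R X dX 1 1)
           (HA R X dX 1) (\<lambda>p. face_rel R X dX `` {p}) \<and>
         equiv (carrier (trace_alg R X dX 1)) (face_rel R X dX) \<and>
         HA R X dX 1 = quotient_alg (trace_alg R X dX 1) (face_rel R X dX)"
proof -
  interpret dspace X dX by fact
  interpret reflexive_pair R "trace_alg R X dX 2" "trace_alg R X dX 1"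
    "trace_face_lin R X dX 1 0" "trace_face_lin R X dX 1 1"
    by (rule reflexive_pair_trace_faces) fact
  have rel: "face_rel R X dX = diff_rel"
    unfolding face_rel_def diff_rel_def by (rule refl)
  have "HA R X dX 1 = quotient_alg (trace_alg R X dX 1) (face_rel R X dX)"
    using racong_eq_diff_rel
    by (simp add: HA_def moore_homology_0 simplicial_trace_alg_def rel numeral_2_eq_2)
  with diff_rel_coequalizer diff_rel_equiv show ?thesis
    by (simp add: rel)
qed

end
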